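(* Let $a,b\in\mathbb{C}$ with $0\le \mathrm{Re}(a)<1$, let $\mathfrak g=\mathcal{HV}(a,b;-1)$ and $\mathfrak h=\mathbb{C}L_{0,0}\subset\mathfrak g$. Then any free $\mathcal{U}(\mathfrak h)$-module of rank one over $\mathfrak g$ is isomorphic, as a $\mathfrak g$-module, to $\Omega_{\mathfrak g}(\lambda,\alpha,\beta,\gamma,\boldsymbol\kappa)$ for some $\lambda\in\mathbb{C}^*$, $\alpha,\beta,\gamma\in\mathbb{C}$ and some family $\boldsymbol\kappa=(\kappa_i)_{i\in\mathbb{Z}}$ of complex numbers, where $\Omega_{\mathfrak g}(\lambda,\alpha,\beta,\gamma,\boldsymbol\kappa)=\mathbb{C}[t]$ as a vector space, with actions, for $i\in\mathbb{Z}$, $m\in\mathbb{Z}_+$, $f(t)\in\mathbb{C}[t]$, $$L_{i,m}\cdot f(t)=\sum_{s=0}^{+\infty}\binom{-m}{s}\lambda^i\beta^{m+s}(t-i\alpha-(m+s)\alpha\beta)f^{(s)}(t-i),$$ and $$H_{i,m}\cdot f(t)=\begin{cases}\displaystyle\sum_{s=0}^{+\infty}\binom{-m}{s}\lambda^i\beta^{m+s}\gamma f^{(s)}(t-a-i), & b=0,\\ \displaystyle\sum_{s=0}^{+\infty}\binom{-m}{s}\varphi^{(a)}_{i,m+s}(\lambda,\beta,\gamma,\kappa_i)f^{(s)}(t-a-i), & b=1,\ a\neq0,\\ \displaystyle\sum_{s=0}^{+\infty}\binom{-m}{s}\psi_{i,m+s}(\gamma,\kappa_i)f^{(s)}(t-i),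 & b=1,\ a=0,\\ 0, & \text{otherwise}.\end{cases}$$
   Context: $\mathbb{Z}_+$ is the set of nonnegative integers and $\mathbb{C}^*=\mathbb{C}\setminus\{0\}$. $\mathcal{HV}(a,b;-1)$ is the complex Lie algebra with basis $\{L_{i,m},H_{j,n}\mid i,j\in\mathbb{Z},\,m,n\in\mathbb{Z}_+\}$ and brackets $[L_{i,m},L_{j,n}]=(j-i)L_{i+j,m+n}+(n-m)L_{i+j,m+n+1}$, $[L_{i,m},H_{j,n}]=(a+j+bi)H_{i+j,m+n}+(n+bm)H_{i+j,m+n+1}$, $[H_{i,m},H_{j,n}]=0$. A free $\mathcal{U}(\mathfrak h)$-module of rank one over $\mathfrak g$ is a $\mathfrak g$-module whose restriction to $\mathcal{U}(\mathfrak h)=\mathbb{C}[L_{0,0}]$ is free of rank one. $f^{(s)}$ is the $s$-th derivative of $f$. For $m\in\mathbb{Z}$, $n\in\mathbb{Z}_+$ the generalized binomial coefficient is $\binom{m}{0}=1$ and $\binom{m}{n}=\frac{1}{n!}\prod_{i=m-n+1}^{m}i$ for $n>0$. The scalars are $$\varphi^{(a)}_{i,m}(\lambda,\beta,\gamma,\kappa_i)=\delta_{m,0}\frac{a}{a+i}\lambda^i\gamma+\frac{(-1)^{m-1}}{(m-1)!}(a+i)^{m-1}\kappa_i+\sum_{\ell=0}^{m-2}\frac{(m-\ell-2)!}{(m-1)!}(-1)^\ell(a+i)^\ell a\lambda^i\beta^{m-\ell-1}\gamma,$$ $$\psi_{i,m}(\gamma,\kappa_i)=\delta_{i,0}\delta_{m,0}\gamma+\frac{(-i)^{m-1}}{(m-1)!}\kappa_i,$$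 where $0^0=1$, empty sums are $0$, and for $m=0$ the terms containing $\frac{1}{(m-1)!}$ are read as $0$; thus $\varphi^{(a)}_{i,0}=\frac{a}{a+i}\lambda^i\gamma$ and $\psi_{i,0}=\delta_{i,0}\gamma$. *)

theory Defs
  imports Complex_Main "HOL-Computational_Algebra.Polynomial" "HOL-Library.Poly_Mapping"
begin

section \<open>Lie algebras and their modules\<close>

locale lie_algebra = vector_space scale
  for scale :: "'k::field \<Rightarrow> 'g::ab_group_add \<Rightarrow> 'g" +
  fixes bracket :: "'g \<Rightarrow> 'g \<Rightarrow> 'g"
  assumes bracket_linear_left: "Vector_Spaces.linear scale scale (\<lambda>x. bracket x y)"
    and bracket_linear_right: "Vector_Spaces.linear scale scale (bracket x)"
    and bracket_self: "bracket x x = 0"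
    and jacobi: "bracket x (bracket y z) + bracket y (bracket z x) + bracket z (bracket x y) = 0"

locale lie_module = lie_algebra scale bracket
  for scale :: "'k::field \<Rightarrow> 'g::ab_group_add \<Rightarrow> 'g"
    and bracket :: "'g \<Rightarrow> 'g \<Rightarrow> 'g" +
  fixes mscale :: "'k \<Rightarrow> 'v::ab_group_add \<Rightarrow> 'v"
    and act :: "'g \<Rightarrow> 'v \<Rightarrow> 'v"
  assumes act_linear_left: "Vector_Spaces.linear scale mscale (\<lambda>x. act x v)"
    and act_linear_right: "Vector_Spaces.linear mscale mscale (act x)"
    and act_bracket: "act (bracket x y) v = act x (act y v) - act y (act x v)"

definition lie_module_isomorphic ::
  "('k::field \<Rightarrow> 'g::ab_group_add \<Rightarrow> 'g) \<Rightarrow> ('g \<Rightarrow> 'g \<Rightarrow> 'g) \<Rightarrow>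
   ('k \<Rightarrow> 'v::ab_group_add \<Rightarrow> 'v) \<Rightarrow> ('g \<Rightarrow> 'v \<Rightarrow> 'v) \<Rightarrow>
   ('k \<Rightarrow> 'w::ab_group_add \<Rightarrow> 'w) \<Rightarrow> ('g \<Rightarrow> 'w \<Rightarrow> 'w) \<Rightarrow> bool"
  where "lie_module_isomorphic scale bracket mscale act mscale' act' \<longleftrightarrow>
    lie_module scale bracket mscale act \<and> lie_module scale bracket mscale' act' \<and>
    (\<exists>\<phi>. Vector_Spaces.linear mscale mscale' \<phi> \<and> bij \<phi> \<and>
         (\<forall>x v. \<phi> (act x v) = act' x (\<phi> v)))"


section \<open>Restriction to a one-dimensional subalgebra\<close>

text \<open>
  For a one-dimensional Lie algebra spanned by \<open>X\<close>, the universal enveloping algebra is the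
  polynomial ring in \<open>X\<close>. If \<open>X\<close> acts by the linear operator \<open>T\<close>, the polynomial \<open>p\<close> acts
  by \<open>p(T)\<close>.
\<close>

definition poly_action ::
  "('k::field \<Rightarrow> 'v::ab_group_add \<Rightarrow> 'v) \<Rightarrow> ('v \<Rightarrow> 'v) \<Rightarrow> 'k poly \<Rightarrow> 'v \<Rightarrow> 'v"
  where "poly_action mscale T p v = (\<Sum>k\<le>degree p. mscale (coeff p k) ((T ^^ k) v))"

definition free_of_rank_one :: "('r::comm_ring_1 \<Rightarrow> 'v::ab_group_add \<Rightarrow> 'v) \<Rightarrow> bool"
  where "free_of_rank_one rscale \<longleftrightarrow>
    module rscale \<and> (\<exists>v. \<not> module.dependent rscale {v} \<and> module.span rscale {v} = UNIV)"

lemma poly_action_bound: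
  assumes "vector_space mscale" "degree p \<le> n"
  shows "poly_action mscale T p v = (\<Sum>k\<le>n. mscale (coeff p k) ((T ^^ k) v))"
proof -
  interpret vector_space mscale by fact
  show ?thesis
    unfolding poly_action_def
    by (rule sum.mono_neutral_left) (use assms(2) in \<open>auto simp: coeff_eq_0\<close>)
qed

lemma poly_action_module:
  assumes "Vector_Spaces.linear mscale mscale T"
  shows "module (poly_action mscale T)"
proof -
  interpret T: Vector_Spaces.linear mscale mscale T by fact
  note vs = T.vs1.vector_space_axioms
  have pow_add: "(T ^^ k) (x + y) = (T ^^ k) x + (T ^^ k) y" for k x y
    by (induction k) (auto simp: T.add)
  have pow_scale: "(T ^^ k) (mscale c x) = mscale c ((T ^^ k) x)" for k c x
    by (induction k) (auto simp: T.scale)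
  have right_add: "poly_action mscale T p (x + y) = poly_action mscale T p x + poly_action mscale T p y"
    for p x y
    by (simp add: poly_action_def pow_add T.vs1.scale_right_distrib sum.distrib)
  have left_add: "poly_action mscale T (p + q) x = poly_action mscale T p x + poly_action mscale T q x"
    for p q x
  proof -
    let ?n = "max (degree p) (degree q)"
    have "degree (p + q) \<le> ?n" by (rule degree_add_le_max)
    then show ?thesis
      by (simp add: poly_action_bound[OF vs, of _ ?n] T.vs1.scale_left_distrib sum.distrib)
  qed
  have smult: "poly_action mscale T (smult c p) x = mscale c (poly_action mscale T p x)" for c p x
    by (simp add: poly_action_bound[OF vs, of _ "degree p"] degree_smult_le T.vs1.scale_sum_right)
  have pCons: "poly_action mscale T (pCons c p) x = mscale c x + T (poly_action mscale T p x)"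
    for c p x
  proof -
    have "poly_action mscale T (pCons c p) x =
        (\<Sum>k\<le>Suc (degree p). mscale (coeff (pCons c p) k) ((T ^^ k) x))"
      by (rule poly_action_bound[OF vs]) (rule degree_pCons_le)
    also have "\<dots> = mscale c x + (\<Sum>k\<le>degree p. T (mscale (coeff p k) ((T ^^ k) x)))"
      by (subst sum.atMost_Suc_shift) (simp add: T.scale)
    finally show ?thesis by (simp add: poly_action_def T.sum)
  qed
  have zero: "poly_action mscale T 0 x = 0" for x by (simp add: poly_action_def)
  have comp: "poly_action mscale T p (poly_action mscale T q x) = poly_action mscale T (p * q) x"
    for p q x
    by (induction p) (simp_all add: zero pCons left_add smult)
  show ?thesis
    by unfold_locales (simp_all add: right_add left_add comp, simp add: poly_action_def)
qed


section \<open>The Lie algebra\<close>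

text \<open>
  An element of the algebra is a finitely supported family of coefficients on the basis.
\<close>

datatype hv_index = L int nat | H int nat

type_synonym hv = "hv_index \<Rightarrow>\<^sub>0 complex"

definition hv_scale :: "complex \<Rightarrow> hv \<Rightarrow> hv"
  where "hv_scale c x = Poly_Mapping.map ((*) c) x"

definition linear_extension ::
  "(complex \<Rightarrow> 'v::ab_group_add \<Rightarrow> 'v) \<Rightarrow> (hv_index \<Rightarrow> 'v) \<Rightarrow> hv \<Rightarrow> 'v"
  where "linear_extension mscale g x =
    (\<Sum>u\<in>Poly_Mapping.keys x. mscale (Poly_Mapping.lookup x u) (g u))"

fun hv_bracket_basis :: "complex \<Rightarrow> complex \<Rightarrow> hv_index \<Rightarrow> hv_index \<Rightarrow> hv"
  where
    "hv_bracket_basis a b (L i m) (L j n) =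
       Poly_Mapping.single (L (i + j) (m + n)) (of_int j - of_int i) +
       Poly_Mapping.single (L (i + j) (m + n + 1)) (of_nat n - of_nat m)"
  | "hv_bracket_basis a b (L i m) (H j n) =
       Poly_Mapping.single (H (i + j) (m + n)) (a + of_int j + b * of_int i) +
       Poly_Mapping.single (H (i + j) (m + n + 1)) (of_nat n + b * of_nat m)"
  | "hv_bracket_basis a b (H j n) (L i m) =
       - (Poly_Mapping.single (H (i + j) (m + n)) (a + of_int j + b * of_int i) +
          Poly_Mapping.single (H (i + j) (m + n + 1)) (of_nat n + b * of_nat m))"
  | "hv_bracket_basis a b (H i m) (H j n) = 0"

definition hv_bracket :: "complex \<Rightarrow> complex \<Rightarrow> hv \<Rightarrow> hv \<Rightarrow> hv"
  where "hv_bracket a b x y =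
    linear_extension hv_scale (\<lambda>u. linear_extension hv_scale (hv_bracket_basis a b u) y) x"

lemma lookup_hv_scale [simp]:
  "Poly_Mapping.lookup (hv_scale c x) u = c * Poly_Mapping.lookup x u"
  by (simp add: hv_scale_def Poly_Mapping.map.rep_eq when_def)

lemma hv_scale_single [simp]:
  "hv_scale c (Poly_Mapping.single u d) = Poly_Mapping.single u (c * d)"
  by (rule poly_mapping_eqI) (simp add: lookup_single when_def)

lemma vector_space_hv: "vector_space hv_scale"
  by unfold_locales (rule poly_mapping_eqI; simp add: lookup_add algebra_simps)+

lemma linear_extension_superset:
  assumes "vector_space mscale" "finite A" "Poly_Mapping.keys x \<subseteq> A"
  shows "linear_extension mscale g x = (\<Sum>u\<in>A. mscale (Poly_Mapping.lookup x u) (g u))"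
proof -
  interpret vector_space mscale by fact
  show ?thesis
    unfolding linear_extension_def
    by (rule sum.mono_neutral_left) (use assms in \<open>auto simp: in_keys_iff\<close>)
qed

lemma linear_linear_extension:
  assumes "vector_space mscale"
  shows "Vector_Spaces.linear hv_scale mscale (linear_extension mscale g)"
proof -
  interpret vector_space mscale by fact
  interpret hv: vector_space hv_scale by (rule vector_space_hv)
  show ?thesis
  proof (unfold_locales)
    fix x y :: hv and c :: complex
    let ?A = "Poly_Mapping.keys x \<union> Poly_Mapping.keys y"
    have sub: "Poly_Mapping.keys (x + y) \<subseteq> ?A" "Poly_Mapping.keys (hv_scale c x) \<subseteq> ?A"
      by (auto simp: in_keys_iff lookup_add)
    show "linear_extension mscale g (x + y) = linear_extension mscale g x + linear_extension mscale g y"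
      using sub by (simp add: linear_extension_superset[OF assms, of ?A] lookup_add
          scale_left_distrib sum.distrib)
    show "linear_extension mscale g (hv_scale c x) = mscale c (linear_extension mscale g x)"
      using sub by (simp add: linear_extension_superset[OF assms, of ?A] scale_sum_right)
  qed
qed

lemma linear_extension_single [simp]:
  assumes "vector_space mscale"
  shows "linear_extension mscale g (Poly_Mapping.single u c) = mscale c (g u)"
proof -
  interpret vector_space mscale by fact
  show ?thesis by (simp add: linear_extension_def)
qed

lemma hv_bracket_linear_left:
  "Vector_Spaces.linear hv_scale hv_scale (\<lambda>x. hv_bracket a b x y)"
  unfolding hv_bracket_def by (rule linear_linear_extension[OF vector_space_hv])

lemma hv_bracket_linear_right: "Vector_Spaces.linear hv_scale hv_scale (hv_bracket a b x)"
proof -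
  interpret hv: vector_space hv_scale by (rule vector_space_hv)
  interpret l: Vector_Spaces.linear hv_scale hv_scale "linear_extension hv_scale g" for g
    by (rule linear_linear_extension[OF vector_space_hv])
  show ?thesis
    by unfold_locales
      (simp_all add: hv_bracket_def linear_extension_def[of _ _ x] l.add l.scale
        hv.scale_right_distrib sum.distrib hv.scale_sum_right hv.scale_left_commute mult.commute)
qed

lemma hv_bracket_single [simp]:
  "hv_bracket a b (Poly_Mapping.single u c) (Poly_Mapping.single v d) =
   hv_scale (c * d) (hv_bracket_basis a b u v)"
proof -
  interpret hv: vector_space hv_scale by (rule vector_space_hv)
  show ?thesis by (simp add: hv_bracket_def vector_space_hv)
qed

lemma hv_induct [case_names single sum]:
  fixes x :: hv
  assumes single: "\<And>u c. P (Poly_Mapping.single u c)"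
    and sum: "\<And>x y. P x \<Longrightarrow> P y \<Longrightarrow> P (x + y)"
  shows "P x"
proof (induction "card (Poly_Mapping.keys x)" arbitrary: x)
  case 0
  then have "x = Poly_Mapping.single undefined 0" by simp
  then show ?case using single by metis
next
  case (Suc n)
  then obtain u where u: "u \<in> Poly_Mapping.keys x"
    by (metis card.empty equals0I nat.distinct(1))
  define y where "y = x - Poly_Mapping.single u (Poly_Mapping.lookup x u)"
  have "Poly_Mapping.keys y = Poly_Mapping.keys x - {u}"
    by (auto simp: y_def in_keys_iff lookup_minus lookup_single when_def split: if_splits)
  then have "P y" using Suc u by (intro Suc.hyps(1)) simp
  then have "P (y + Poly_Mapping.single u (Poly_Mapping.lookup x u))" by (intro sum single)
  then show ?case by (simp add: y_def)
qed

theorem lie_algebra_hv: "lie_algebra hv_scale (hv_bracket a b)"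
proof -
  interpret hv: vector_space hv_scale by (rule vector_space_hv)
  interpret l: Vector_Spaces.linear hv_scale hv_scale "\<lambda>x. hv_bracket a b x y" for y
    by (rule hv_bracket_linear_left)
  interpret r: Vector_Spaces.linear hv_scale hv_scale "hv_bracket a b x" for x
    by (rule hv_bracket_linear_right)
  let ?s = "\<lambda>u c. Poly_Mapping.single u c :: hv"
  have anti: "hv_bracket a b x y + hv_bracket a b y x = 0" for x y
  proof (induction x rule: hv_induct)
    case (single u c)
    show ?case
    proof (induction y rule: hv_induct)
      case (single v d)
      show ?case
        by (cases u; cases v; intro poly_mapping_eqI)
          (auto simp: lookup_add lookup_minus lookup_single when_def algebra_simps)
    next
      case (sum f g)
      then show ?case by (simp add: l.add r.add algebra_simps)
    qed
  next
    case (sum f g)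
    have "hv_bracket a b (f + g) y + hv_bracket a b y (f + g) =
      (hv_bracket a b f y + hv_bracket a b y f) + (hv_bracket a b g y + hv_bracket a b y g)"
      by (simp add: l.add r.add)
    then show ?case using sum by simp
  qed
  have self: "hv_bracket a b x x = 0" for x
  proof (rule poly_mapping_eqI)
    fix u
    have "Poly_Mapping.lookup (hv_bracket a b x x + hv_bracket a b x x) u = 0"
      by (simp add: anti)
    then show "Poly_Mapping.lookup (hv_bracket a b x x) u = Poly_Mapping.lookup 0 u"
      by (simp add: lookup_add)
  qed
  define J where "J x y z = hv_bracket a b x (hv_bracket a b y z) +
    hv_bracket a b y (hv_bracket a b z x) + hv_bracket a b z (hv_bracket a b x y)" for x y z
  have J1: "J (x + x') y z = J x y z + J x' y z" for x x' y z
    by (simp add: J_def l.add r.add)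
  have J2: "J x (y + y') z = J x y z + J x y' z" for x y y' z
    by (simp add: J_def l.add r.add)
  have J3: "J x y (z + z') = J x y z + J x y z'" for x y z z'
    by (simp add: J_def l.add r.add)
  have base: "J (?s u c) (?s v d) (?s w e) = 0" for u v w c d e
    by (cases u; cases v; cases w; intro poly_mapping_eqI)
      (auto simp: J_def l.add r.add l.neg r.neg l.diff r.diff hv.scale_right_distrib hv.scale_minus_right hv.scale_right_diff_distrib
        lookup_add lookup_minus lookup_single when_def algebra_simps)
  have "J x y z = 0" for x y z
  proof (induction x rule: hv_induct)
    case (single u c)
    show ?case
    proof (induction y rule: hv_induct)
      case (single v d)
      show ?case
        by (induction z rule: hv_induct) (simp_all add: base J3)
    qed (simp add: J2)
  qed (simp add: J1)
  then show ?thesis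
    by (intro lie_algebra.intro lie_algebra_axioms.intro vector_space_hv hv_bracket_linear_left
        hv_bracket_linear_right self) (simp add: J_def)
qed


section \<open>The modules \<open>\<Omega>\<close>\<close>

definition \<phi>_scalar ::
  "complex \<Rightarrow> int \<Rightarrow> nat \<Rightarrow> complex \<Rightarrow> complex \<Rightarrow> complex \<Rightarrow> complex \<Rightarrow> complex"
  where "\<phi>_scalar a i m lam \<beta> \<gamma> \<kappa>i =
    (if m = 0 then a / (a + of_int i) * lam powi i * \<gamma>
     else (-1) ^ (m - 1) / fact (m - 1) * (a + of_int i) ^ (m - 1) * \<kappa>i +
       (\<Sum>l<m - 1. fact (m - l - 2) / fact (m - 1) * (-1) ^ l * (a + of_int i) ^ l * a *
          lam powi i * \<beta> ^ (m - l - 1) * \<gamma>))"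

definition \<psi>_scalar :: "int \<Rightarrow> nat \<Rightarrow> complex \<Rightarrow> complex \<Rightarrow> complex"
  where "\<psi>_scalar i m \<gamma> \<kappa>i =
    (if m = 0 then (if i = 0 then \<gamma> else 0)
     else (- of_int i) ^ (m - 1) / fact (m - 1) * \<kappa>i)"

text \<open>The polynomial \<open>f\<^sup>(\<^sup>s\<^sup>)(t - c)\<close>.\<close>

definition shifted_deriv :: "nat \<Rightarrow> complex \<Rightarrow> complex poly \<Rightarrow> complex poly"
  where "shifted_deriv s c f = pcompose ((pderiv ^^ s) f) [:- c, 1:]"

text \<open>
  The sums over all \<open>s\<close> are cut off at the degree of \<open>f\<close>, beyond which the derivatives of \<open>f\<close>
  vanish.
\<close>

fun \<Omega>_basis ::
  "complex \<Rightarrow> complex \<Rightarrow> complex \<Rightarrow> complex \<Rightarrow> complex \<Rightarrow> complex \<Rightarrow> (int \<Rightarrow> complex) \<Rightarrow>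
   hv_index \<Rightarrow> complex poly \<Rightarrow> complex poly"
  where
    "\<Omega>_basis a b lam \<alpha> \<beta> \<gamma> \<kappa> (L i m) f =
       (\<Sum>s\<le>degree f. smult (((- of_nat m) gchoose s) * lam powi i * \<beta> ^ (m + s))
          ([:- (of_int i * \<alpha>) - of_nat (m + s) * \<alpha> * \<beta>, 1:] * shifted_deriv s (of_int i) f))"
  | "\<Omega>_basis a b lam \<alpha> \<beta> \<gamma> \<kappa> (H i m) f =
       (if b = 0 then
          \<Sum>s\<le>degree f. smult (((- of_nat m) gchoose s) * lam powi i * \<beta> ^ (m + s) * \<gamma>)
            (shifted_deriv s (a + of_int i) f)
        else if b = 1 \<and> a \<noteq> 0 then
          \<Sum>s\<le>degree f. smult (((- of_nat m) gchoose s) * \<phi>_scalar a i (m + s) lam \<beta> \<gamma> (\<kappa> i))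
            (shifted_deriv s (a + of_int i) f)
        else if b = 1 \<and> a = 0 then
          \<Sum>s\<le>degree f. smult (((- of_nat m) gchoose s) * \<psi>_scalar i (m + s) \<gamma> (\<kappa> i))
            (shifted_deriv s (of_int i) f)
        else 0)"

definition \<Omega> ::
  "complex \<Rightarrow> complex \<Rightarrow> complex \<Rightarrow> complex \<Rightarrow> complex \<Rightarrow> complex \<Rightarrow> (int \<Rightarrow> complex) \<Rightarrow>
   hv \<Rightarrow> complex poly \<Rightarrow> complex poly"
  where "\<Omega> a b lam \<alpha> \<beta> \<gamma> \<kappa> x f =
    linear_extension smult (\<lambda>u. \<Omega>_basis a b lam \<alpha> \<beta> \<gamma> \<kappa> u f) x"

lemma pderiv_funpow_eq_0: "degree f < s \<Longrightarrow> (pderiv ^^ s) f = 0"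
  for f :: "complex poly"
proof (induction s arbitrary: f)
  case (Suc s)
  show ?case
  proof (cases "degree f = 0")
    case True
    then have "pderiv f = 0" by (simp add: pderiv_eq_0_iff)
    moreover have "(pderiv ^^ s) (0 :: complex poly) = 0" by (induction s) auto
    ultimately show ?thesis by (simp add: funpow_swap1)
  next
    case False
    then have "degree (pderiv f) < s" using Suc.prems by (simp add: degree_pderiv)
    then show ?thesis using Suc.IH by (simp add: funpow_swap1)
  qed
qed simp

end

theory Submission
  imports Defs
begin

text \<open>
  Identify the module with \<open>\<complex>[t]\<close>, \<open>L\<^bsub>0,0\<^esub>\<close> acting as multiplication by \<open>t\<close>. Bracketing with
  \<open>L\<^bsub>0,0\<^esub>\<close> gives \<open>L\<^bsub>i,m\<^esub>(t f) = (t - i) L\<^bsub>i,m\<^esub> f - m L\<^bsub>i,m+1\<^esub> f\<close>, and similarly for \<open>H\<close>, so every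
  operator is a differential operator with infinite expansion determined by the images of \<open>1\<close>.

  Comparing leading coefficients in the Witt relations gives \<open>L\<^bsub>i,0\<^esub> 1 = \<lambda>\<^sup>i (t - i\<alpha>)\<close>. For
  \<open>m \<ge> 1\<close>, the brackets with all \<open>L\<^bsub>i,0\<^esub>\<close> show that if \<open>L\<^bsub>0,m\<^esub> 1\<close> had degree \<open>N \<ge> 2\<close>, then \<open>\<alpha>\<close>
  would be a root of a quadratic polynomial depending on \<open>N\<close>, and \<open>L\<^bsub>0,m+1\<^esub> 1\<close> would have degree
  \<open>N + 1\<close>. The quadratics for \<open>N\<close>, \<open>N + 1\<close>, \<open>N + 2\<close> have no common root, so the images are linear,
  and their leading coefficients are multiplicative in \<open>m\<close>.

  Finally \<open>[H\<^bsub>i,0\<^esub>, H\<^bsub>j,0\<^esub>] = 0\<close> forces the images of \<open>1\<close> under \<open>H\<^bsub>j,0\<^esub>\<close> to be constant, and the brackets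
  \<open>[L\<^bsub>i,m\<^esub>, H\<^bsub>j,0\<^esub>]\<close> give the remaining ones, up to one free constant for each \<open>i\<close> when \<open>b = 1\<close>.
\<close>

section \<open>Translated polynomials\<close>

definition shift :: "complex \<Rightarrow> complex poly \<Rightarrow> complex poly"
  where "shift c p = pcompose p [:- c, 1:]"

lemma shift_pCons: "shift c (pCons x p) = [:x:] + [:- c, 1:] * shift c p"
  by (simp add: shift_def pcompose_pCons)

lemma shift_const [simp]: "shift c 0 = 0" "shift c 1 = 1" "shift c [:x:] = [:x:]"
  by (simp_all add: shift_def pcompose_1)

lemma shift_add: "shift c (p + q) = shift c p + shift c q"
  by (simp add: shift_def pcompose_add)

lemma shift_smult: "shift c (smult x p) = smult x (shift c p)"
  by (simp add: shift_def pcompose_smult)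

lemma shift_zero [simp]: "shift 0 p = p"
  by (simp add: shift_def)

lemma poly_shift [simp]: "poly (shift c p) x = poly p (x - c)"
  by (simp add: shift_def poly_pcompose)

section \<open>Coefficients of translated polynomials\<close>

lemma coeff_shift:
  assumes "degree p \<le> n"
  shows "coeff (shift c p) r = (\<Sum>q\<in>{r..n}. of_nat (q choose r) * (- c) ^ (q - r) * coeff p q)"
proof -
  have "shift c p = (\<Sum>q\<le>n. smult (coeff p q) ([:- c, 1:] ^ q))"
    using assms
  proof (induction p arbitrary: n)
    case (pCons x p)
    show ?case
    proof (cases "p = 0")
      case True
      then have "(\<Sum>q\<le>n. smult (coeff (pCons x p) q) ([:- c, 1:] ^ q)) =
          (\<Sum>q\<in>{0}. smult (coeff (pCons x p) q) ([:- c, 1:] ^ q))"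
        by (intro sum.mono_neutral_right) (auto simp: coeff_pCons split: nat.splits)
      then show ?thesis using True by simp
    next
      case False
      then obtain m where m: "n = Suc m" "degree p \<le> m"
        using pCons.prems by (cases n) auto
      show ?thesis
        unfolding m(1) sum.atMost_Suc_shift shift_pCons pCons.IH[OF m(2)]
        by (simp add: sum_distrib_left mult.commute)
    qed
  qed simp
  then have "coeff (shift c p) r = (\<Sum>q\<le>n. coeff p q * coeff ([:- c, 1:] ^ q) r)"
    by (simp add: coeff_sum)
  also have "\<dots> = (\<Sum>q\<in>{r..n}. coeff p q * coeff ([:- c, 1:] ^ q) r)"
    by (intro sum.mono_neutral_right)
      (auto intro!: coeff_eq_0 simp: degree_linear_power)
  finally show ?thesis
    by (auto intro!: sum.cong simp: coeff_linear_poly_power)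
qed

lemma coeff_shift_top:
  assumes "degree p \<le> r"
  shows "coeff (shift c p) r = coeff p r"
  using coeff_shift[OF assms, of c r] by simp

text \<open>The binomial sum has at most four terms here. Four are needed later to look two degrees
  below the top of a polynomial that has been multiplied by a linear factor.\<close>

lemma coeff_shift_top3:
  assumes "degree p \<le> r + 3"
  shows "coeff (shift c p) r = coeff p r - of_nat (r + 1) * c * coeff p (r + 1)
    + of_nat ((r + 1) * (r + 2)) / 2 * c ^ 2 * coeff p (r + 2)
    - of_nat ((r + 1) * (r + 2) * (r + 3)) / 6 * c ^ 3 * coeff p (r + 3)"
proof -
  have "{r..r + 3} = {r, r + 1, r + 2, r + 3}" by auto
  moreover have b2: "of_nat (Suc (Suc r) choose r) = (of_nat ((r + 1) * (r + 2)) / 2 :: complex)"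
  proof -
    have "Suc (Suc r) choose r = Suc (Suc r) choose 2"
      by (subst binomial_symmetric) auto
    then show ?thesis
      by (simp add: numeral_2_eq_2 binomial_gbinomial gbinomial_prod_rev field_simps)
  qed
  moreover have b3: "of_nat (Suc (Suc (Suc r)) choose r) =
      (of_nat ((r + 1) * (r + 2) * (r + 3)) / 6 :: complex)"
  proof -
    have "Suc (Suc (Suc r)) choose r = Suc (Suc (Suc r)) choose 3"
      by (subst binomial_symmetric) auto
    then show ?thesis
      by (simp add: numeral_3_eq_3 binomial_gbinomial gbinomial_prod_rev field_simps)
  qed
  ultimately have "coeff (shift c p) r = coeff p r - of_nat (r + 1) * c * coeff p (r + 1)
    + of_nat (Suc (Suc r) choose r) * c ^ 2 * coeff p (r + 2)
    - of_nat (Suc (Suc (Suc r)) choose r) * c ^ 3 * coeff p (r + 3)"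
    using coeff_shift[OF assms, of c r] by (simp add: eval_nat_numeral)
  then show ?thesis unfolding b2 b3 .
qed

lemma coeff_mult_bounded:
  assumes "degree (p :: complex poly) \<le> m" "degree q \<le> n"
  shows "coeff (p * q) (m + n) = coeff p m * coeff q n"
proof -
  have "coeff (p * q) (m + n) = (\<Sum>i\<le>m + n. coeff p i * coeff q (m + n - i))"
    by (rule coeff_mult)
  also have "\<dots> = (\<Sum>i\<in>{m}. coeff p i * coeff q (m + n - i))"
  proof (intro sum.mono_neutral_right ballI)
    fix i assume "i \<in> {..m + n} - {m}"
    then have "i > m \<or> m + n - i > n" by auto
    then show "coeff p i * coeff q (m + n - i) = 0"
      using assms by (auto intro!: coeff_eq_0)
  qed auto
  finally show ?thesis by simp
qed

text \<open>Translation preserves the top coefficient, so \<open>shift c q - q\<close> drops in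
  degree, and its top term comes from the linear part of the binomial expansion.\<close>

lemma coeff_mult_shift_diff:
  assumes "degree p \<le> m" "degree q \<le> n" "m + n = Suc d"
  shows "coeff (p * (shift c q - q)) d = - c * of_nat n * coeff p m * coeff q n"
proof (cases n)
  case 0
  then obtain x where "q = [:x:]" using assms(2) by (auto elim: degree_eq_zeroE)
  then show ?thesis using 0 by simp
next
  case (Suc k)
  have "degree (shift c q - q) \<le> k"
  proof (rule degree_le, intro allI impI)
    fix i assume i: "k < i"
    then have "degree q \<le> i" using assms(2) Suc by linarith
    then show "coeff (shift c q - q) i = 0" by (simp add: coeff_shift_top)
  qed
  then have "coeff (p * (shift c q - q)) (m + k) = coeff p m * coeff (shift c q - q) k"
    using assms(1) by (intro coeff_mult_bounded)
  moreover have "coeff (shift c q) k = coeff q k - of_nat (Suc k) * c * coeff q (Suc k)"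
    using coeff_shift[of q "Suc k" c k] assms(2) Suc by simp
  ultimately show ?thesis using assms(3) Suc by simp
qed

text \<open>The products \<open>p * q\<close> cancel and each remaining difference drops one degree.
  Brackets of level-zero operators have this shape, so the lemma reads off their leading
  coefficients.\<close>

lemma coeff_shift_commutator:
  assumes "degree p \<le> m" "degree q \<le> n" "m + n = Suc d"
  shows "coeff (p * shift x q - q * shift y p) d =
    (y * of_nat m - x * of_nat n) * coeff p m * coeff q n"
proof -
  have decomp: "p * shift x q - q * shift y p = p * (shift x q - q) - q * (shift y p - p)"
    by (simp add: algebra_simps)
  have "n + m = Suc d" using assms(3) by simp
  note * = coeff_mult_shift_diff[OF assms(2,1) this]
  show ?thesis
    unfolding decomp coeff_diff[of _ _ d] coeff_mult_shift_diff[OF assms, of x] *[of y]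
    by (simp add: left_diff_distrib)
qed

section \<open>Expansion of operators in shifted derivatives\<close>

lemma pderiv_funpow_add: "(pderiv ^^ s) (p + q) = (pderiv ^^ s) p + (pderiv ^^ s) (q :: complex poly)"
  by (induction s) (simp_all add: pderiv_add)

lemma pderiv_funpow_const: "(pderiv ^^ s) [:x:] = (if s = 0 then [:x:] else (0 :: complex poly))"
  by (induction s) auto

lemma pderiv_funpow_mult_X:
  "(pderiv ^^ s) ([:0, 1:] * f) = [:0, 1:] * (pderiv ^^ s) f +
     smult (of_nat s) ((pderiv ^^ (s - 1)) (f :: complex poly))"
proof (induction s)
  case (Suc s)
  have "(pderiv ^^ Suc s) ([:0, 1:] * f) = pderiv ((pderiv ^^ s) ([:0, 1:] * f))" by simp
  also have "\<dots> = [:0, 1:] * (pderiv ^^ Suc s) f + (pderiv ^^ s) f +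
      smult (of_nat s) (pderiv ((pderiv ^^ (s - 1)) f))"
    unfolding Suc.IH by (simp add: pderiv_add pderiv_smult pderiv_mult pderiv_pCons)
  also have "smult (of_nat s) (pderiv ((pderiv ^^ (s - 1)) f)) = smult (of_nat s) ((pderiv ^^ s) f)"
    by (cases s) simp_all
  finally show ?case by (simp add: smult_add_left)
qed simp

lemma shifted_deriv_add: "shifted_deriv s c (p + q) = shifted_deriv s c p + shifted_deriv s c q"
  by (simp add: shifted_deriv_def pderiv_funpow_add pcompose_add)

lemma shifted_deriv_const: "shifted_deriv s c [:x:] = (if s = 0 then [:x:] else 0)"
  by (simp add: shifted_deriv_def pderiv_funpow_const)

lemma shifted_deriv_mult_X:
  "shifted_deriv s c ([:0, 1:] * f) =
     [:- c, 1:] * shifted_deriv s c f + smult (of_nat s) (shifted_deriv (s - 1) c f)"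
  unfolding shifted_deriv_def pderiv_funpow_mult_X
  by (simp add: pcompose_add pcompose_smult pcompose_mult pcompose_pCons del: mult_pCons_left)

lemma shifted_deriv_eq_0: "degree f < s \<Longrightarrow> shifted_deriv s c f = 0"
  by (simp add: shifted_deriv_def pderiv_funpow_eq_0)

lemma smult_sum_right: "smult (x :: complex) (\<Sum>i\<in>A. f i) = (\<Sum>i\<in>A. smult x (f i))"
  by (induction A rule: infinite_finite_induct) (simp_all add: smult_add_right)

text \<open>Both sides obey the rule \<open>step\<close> for multiplication by the variable and
  agree on constants, so induction on the polynomial identifies them.\<close>

lemma shift_derivation_expansion:
  fixes X :: "nat \<Rightarrow> complex poly \<Rightarrow> complex poly"
  assumes add: "\<And>n p q. X n (p + q) = X n p + X n q"
    and smult: "\<And>n x p. X n (smult x p) = smult x (X n p)"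
    and step: "\<And>n p. X n ([:0, 1:] * p) = [:- c, 1:] * X n p - smult (of_nat n) (X (n + 1) p)"
  shows "X n f = (\<Sum>s\<le>degree f. smult ((- of_nat n) gchoose s) (X (n + s) 1 * shifted_deriv s c f))"
proof -
  \<comment> \<open>The cutoff \<open>N\<close> is kept apart from the degree of \<open>f\<close>,
    because the recursion \<open>E_X\<close> lowers it by one in its second term.\<close>
  define E where "E N n f = (\<Sum>s\<le>N. smult ((- of_nat n) gchoose s) (X (n + s) 1 * shifted_deriv s c f))"
    for N n f
  have E_mono: "E N n f = E M n f" if "degree f \<le> N" "N \<le> M" for N M n f
    unfolding E_def by (rule sum.mono_neutral_left) (use that in \<open>auto simp: shifted_deriv_eq_0\<close>)
  have E_add: "E N n (f + g) = E N n f + E N n g" for N n f g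
    by (simp add: E_def shifted_deriv_add distrib_left smult_add_right sum.distrib)
  have E_const: "E N n [:x:] = X n [:x:]" for N n x
  proof -
    have "E N n [:x:] = (\<Sum>s\<in>{0}. smult ((- of_nat n) gchoose s) (X (n + s) 1 * shifted_deriv s c [:x:]))"
      unfolding E_def by (rule sum.mono_neutral_right) (auto simp: shifted_deriv_const)
    also have "\<dots> = X n [:x:]"
    proof -
      have "X n [:x:] = smult x (X n 1)" using smult[of n x 1] by simp
      then show ?thesis by (simp add: shifted_deriv_const)
    qed
    finally show ?thesis .
  qed
  have E_X: "E (Suc N) n ([:0, 1:] * f) = [:- c, 1:] * E (Suc N) n f - smult (of_nat n) (E N (n + 1) f)"
    for N n f
  proof -
    \<comment> \<open>Absorption turns the factor \<open>s\<close> that differentiation of a product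
      with the variable creates into the factor \<open>n\<close> of the rule
      \<open>step\<close>.\<close>
    have *: "(- of_nat n gchoose Suc s) * of_nat (Suc s) = - of_nat n * ((- of_nat (n + 1) :: complex) gchoose s)" for s
    proof -
      have "(- of_nat (n + 1) :: complex) = - of_nat n - 1" by simp
      then show ?thesis
        using gbinomial_absorption[of s "- of_nat n :: complex"] by (simp only: mult.commute)
    qed
    have "E (Suc N) n ([:0, 1:] * f) = [:- c, 1:] * E (Suc N) n f +
       (\<Sum>s\<le>Suc N. smult ((- of_nat n gchoose s) * of_nat s) (X (n + s) 1 * shifted_deriv (s - 1) c f))"
    proof -
      have "smult g (Z * (M * D + smult x D')) = M * smult g (Z * D) + smult (g * x) (Z * D')"
        for g x :: complex and Z M D D'
        by (simp add: distrib_left smult_add_right mult.left_commute)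
      then show ?thesis
        unfolding E_def shifted_deriv_mult_X sum_distrib_left sum.distrib[symmetric]
        by (intro sum.cong refl)
    qed
    also have "(\<Sum>s\<le>Suc N. smult ((- of_nat n gchoose s) * of_nat s) (X (n + s) 1 * shifted_deriv (s - 1) c f)) =
       (\<Sum>s\<le>N. smult (- of_nat n * ((- of_nat (n + 1)) gchoose s)) (X (n + 1 + s) 1 * shifted_deriv s c f))"
      unfolding sum.atMost_Suc_shift * by simp
    also have "\<dots> = - smult (of_nat n) (E N (n + 1) f)"
      by (simp add: E_def smult_sum_right sum_negf)
    finally show ?thesis by simp
  qed
  have "X n f = E N n f" if "degree f \<le> N" for N n f
    using that
  proof (induction f arbitrary: N n)
    case 0
    then show ?case using E_const[of N n 0] by simp
  next
    case (pCons x p)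
    show ?case
    proof (cases "p = 0")
      case True
      then show ?thesis by (simp add: E_const)
    next
      case False
      then obtain M where M: "N = Suc M" "degree p \<le> M"
        using pCons.prems by (cases N) auto
      have dec: "pCons x p = [:x:] + [:0, 1:] * p" by simp
      have "X n (pCons x p) = X n [:x:] + ([:- c, 1:] * X n p - smult (of_nat n) (X (n + 1) p))"
        by (subst dec) (simp only: add step)
      also have "\<dots> = E N n [:x:] + E N n ([:0, 1:] * p)"
      proof -
        have "X n p = E (Suc M) n p" "X (n + 1) p = E M (n + 1) p"
          using M by (auto intro!: pCons.IH)
        then show ?thesis by (simp only: M(1) E_const E_X)
      qed
      also have "\<dots> = E N n (pCons x p)" by (subst dec) (simp only: E_add)
      finally show ?thesis .
    qed
  qed
  from this[OF order_refl, of n f] show ?thesis unfolding E_def .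
qed

section \<open>The Witt relations in rank one\<close>

text \<open>\<open>P i\<close> stands for the image of 1 under \<open>L i 0\<close>, which acts as
  translation by \<open>i\<close> followed by multiplication by \<open>P i\<close>. Leading
  coefficients show that every \<open>P i\<close> is linear; its leading coefficient and its root
  are then determined separately.\<close>

lemma witt_rank_one:
  fixes P :: "int \<Rightarrow> complex poly"
  assumes P0: "P 0 = [:0, 1:]"
    and comm: "\<And>i j. P i * shift (of_int i) (P j) - P j * shift (of_int j) (P i) =
      smult (of_int j - of_int i) (P (i + j))"
  obtains lam \<alpha> where "lam \<noteq> 0" "\<And>i. P i = smult (lam powi i) [:- (of_int i * \<alpha>), 1:]"
proof -
  have coeff_comm: "(of_int j - of_int i) * coeff (P (i + j)) d =
      (of_int j * of_nat (degree (P i)) - of_int i * of_nat (degree (P j))) *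
        lead_coeff (P i) * lead_coeff (P j)"
    if "degree (P i) + degree (P j) = Suc d" for i j d
    using coeff_shift_commutator[OF order_refl order_refl that, of "of_int i" "of_int j"]
    by (simp add: comm)
  have nz: "P i \<noteq> 0" if "i \<noteq> 0" for i
  proof
    assume "P i = 0"
    then have "smult (of_int (- i) - of_int i) (P 0) = 0" using comm[of i "- i"] by simp
    then show False using that P0 by simp
  qed
  have nz': "P i \<noteq> 0" for i using nz[of i] P0 by (cases "i = 0") auto
  \<comment> \<open>The bracket for \<open>i\<close> and \<open>- i\<close> is a nonzero multiple of
    \<open>P 0\<close>, which has degree 1, and the coefficient one below the degree of the product
    does not cancel.\<close>
  have deg_sum: "degree (P i) + degree (P (- i)) = 2" if "i \<noteq> 0" for i
  proof (cases "degree (P i) + degree (P (- i))")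
    case 0
    then obtain x y where "P i = [:x:]" "P (- i) = [:y:]"
      by (metis add_is_0 degree_eq_zeroE)
    then have "smult (of_int (- i) - of_int i) (P 0) = 0" using comm[of i "- i"] by simp
    then show ?thesis using that P0 by simp
  next
    case (Suc d)
    have "(of_int (- i) - of_int i) * coeff (P 0) d =
        - of_int i * of_nat (Suc d) * lead_coeff (P i) * lead_coeff (P (- i))"
      using coeff_comm[OF Suc] unfolding Suc[symmetric] by (simp add: algebra_simps)
    moreover have "- of_int i * of_nat (Suc d) * lead_coeff (P i) * lead_coeff (P (- i)) \<noteq> 0"
      using that nz' by (simp del: of_nat_Suc)
    ultimately have "coeff [:0, 1::complex:] d \<noteq> 0" unfolding P0 by auto
    then have "d = 1" by (auto simp: coeff_pCons split: nat.splits)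
    then show ?thesis using Suc by simp
  qed
  \<comment> \<open>If \<open>P i\<close> had degree 2, then \<open>P (- i)\<close> would be
    constant. It is proportional to the bracket for \<open>i\<close> and \<open>- (2 * i)\<close>,
    whose coefficient at the positive degree \<open>Suc q\<close> is a nonzero multiple of
    \<open>4 + q\<close>.\<close>
  have not2: "degree (P i) \<noteq> 2" if "i \<noteq> 0" for i
  proof
    assume deg: "degree (P i) = 2"
    define q where "q = degree (P (- (2 * i)))"
    have eq: "degree (P i) + degree (P (- (2 * i))) = Suc (Suc q)" using deg by (simp add: q_def)
    have "degree (P (- i)) = 0" using deg_sum[OF that] deg by simp
    then have "coeff (P (- i)) (Suc q) = 0" by (simp add: coeff_eq_0)
    then have "(of_int (- (2 * i)) * of_nat 2 - of_int i * of_nat q) *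
        lead_coeff (P i) * lead_coeff (P (- (2 * i))) = (0 :: complex)"
      using coeff_comm[OF eq] deg by (simp add: q_def)
    then have "of_int (- (2 * i)) * of_nat 2 - of_int i * of_nat q = (0 :: complex)"
      using nz' by simp
    then have "of_int i * of_nat (4 + q) = (0 :: complex)"
      by (simp del: mult_eq_0_iff) algebra
    then show False using that by (simp del: of_nat_add)
  qed
  have deg1: "degree (P i) = 1" for i
  proof (cases "i = 0")
    case False
    then show ?thesis using deg_sum[of i] not2[of i] not2[of "- i"] by simp
  qed (simp add: P0)
  define l where "l i = coeff (P i) 1" for i
  define x where "x i = - coeff (P i) 0 / l i" for i
  have l_nz: "l i \<noteq> 0" for i
    using nz'[of i] deg1[of i] leading_coeff_0_iff[of "P i"] by (simp add: l_def)
  have P_form: "P i = smult (l i) [:- x i, 1:]" for i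
  proof (rule poly_eqI)
    fix n
    show "coeff (P i) n = coeff (smult (l i) [:- x i, 1:]) n"
      using deg1[of i] l_nz[of i]
      by (auto simp: x_def coeff_pCons l_def intro: coeff_eq_0 split: nat.splits)
  qed
  have comm': "(of_int j - of_int i) * l (i + j) = (of_int j - of_int i) * (l i * l j)"
     "(of_int j - of_int i) * (l (i + j) * x (i + j)) =
      l i * l j * (of_int j * x j - of_int i * x i)" for i j
  proof -
    have "coeff (P i * shift (of_int i) (P j) - P j * shift (of_int j) (P i)) n =
        coeff (smult (of_int j - of_int i) (P (i + j))) n" for n
      by (simp add: comm)
    from this[of 1] this[of 0] show "(of_int j - of_int i) * l (i + j) = (of_int j - of_int i) * (l i * l j)"
      "(of_int j - of_int i) * (l (i + j) * x (i + j)) =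
      l i * l j * (of_int j * x j - of_int i * x i)"
      unfolding P_form[of i] P_form[of j] P_form[of "i + j"]
      by (simp_all add: shift_pCons shift_smult algebra_simps)
  qed
  have l0: "l 0 = 1" and x0: "x 0 = 0" by (simp_all add: l_def x_def P0)
  have l_add_ne: "l (i + j) = l i * l j" if "i \<noteq> j" for i j
    using comm'(1)[of j i] that by simp
  \<comment> \<open>For equal nonzero indices the relation is vacuous. The value at
    \<open>2 * i\<close> is recovered by computing the value at \<open>4 * i\<close> along
    \<open>2 * i\<close>, \<open>3 * i\<close>, \<open>4 * i\<close> and then adding
    \<open>- (2 * i)\<close>.\<close>
  have l_add: "l (i + j) = l i * l j" for i j
  proof (cases "i = j \<and> i \<noteq> 0")
    case True
    have 1: "l (4 * i) * l (- (2 * i)) = l (2 * i)" "l (2 * i) * l (- (2 * i)) = 1"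
      using True l_add_ne[of "4 * i" "- (2 * i)"] l_add_ne[of "2 * i" "- (2 * i)"] by (simp_all add: l0)
    have 2: "l (4 * i) = l (2 * i) * l i * l i"
      using True l_add_ne[of "3 * i" "i"] l_add_ne[of "2 * i" i] by (simp add: algebra_simps)
    have "l (2 * i) = (l (2 * i) * l (- (2 * i))) * (l i * l i)"
      using 1(1) unfolding 2 by (simp only: mult_ac)
    then have "l (2 * i) = l i * l i" unfolding 1(2) by simp
    moreover have "i + j = 2 * i" "l j = l i" using True by simp_all
    ultimately show ?thesis by (simp only:)
  qed (use l_add_ne[of i j] l0 in auto)
  have l_powi: "l i = l 1 powi i" for i
  proof (induction i rule: int_induct[where k = 0])
    case (step1 i)
    then show ?case using l_nz l_add[of i 1] by (simp add: power_int_add)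
  next
    case (step2 i)
    then show ?case using l_nz[of 1] l_add[of "i - 1" 1] by (simp add: power_int_diff field_simps)
  qed (simp add: l0)
  have x_comm: "(of_int j - of_int i) * x (i + j) = of_int j * x j - of_int i * x i" for i j
  proof -
    have "l i * l j * ((of_int j - of_int i) * x (i + j)) = l i * l j * (of_int j * x j - of_int i * x i)"
      using comm'(2)[of j i] unfolding l_add by (simp only: mult_ac)
    moreover have "l i * l j \<noteq> 0" using l_nz by simp
    ultimately show ?thesis by (metis mult_left_cancel)
  qed
  have x_neg: "x (- i) = - x i" for i
  proof (cases "i = 0")
    case False
    have "of_int i * (x (- i) + x i) = 0" using x_comm[of i "- i"] by (simp add: x0 algebra_simps)
    then show ?thesis using False by (simp add: eq_neg_iff_add_eq_0)
  qed (simp add: x0)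
  \<comment> \<open>The pair (1, 1) gives nothing, so \<open>x 3\<close> is eliminated between the
    pairs (1, 2) and (-1, 3).\<close>
  have x2: "x 2 = 2 * x 1"
    using x_comm[of 1 2] x_comm[of "-1" 3] x_neg[of 1] by simp algebra
  have x_nat: "x (int n) = of_nat n * x 1" for n
  proof (induction n)
    case (Suc n)
    show ?case
    proof (cases "n = 1")
      case True
      then show ?thesis using x2 by simp
    next
      case False
      have "(of_nat n - 1) * x (1 + int n) = (of_nat n - 1) * ((of_nat n + 1) * x 1)"
        using x_comm[of 1 "int n"] Suc.IH by (simp add: algebra_simps)
      moreover have "of_nat n - 1 \<noteq> (0 :: complex)" using False by simp
      ultimately show ?thesis by (simp add: add.commute)
    qed
  qed (simp add: x0)
  have x_lin: "x i = of_int i * x 1" for i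
    using x_nat[of "nat i"] x_nat[of "nat (- i)"] x_neg[of i] by (cases "i \<ge> 0") auto
  have "P i = smult (l 1 powi i) [:- (of_int i * x 1), 1:]" for i
    by (subst P_form) (simp only: l_powi[of i] x_lin[of i])
  with l_nz[of 1] show thesis by (rule that)
qed

section \<open>Families of polynomials twisted by the Witt action\<close>

text \<open>For \<open>p\<close> of degree at most \<open>r + 2\<close> this is the coefficient at
  \<open>r\<close> of \<open>[:- (c * \<alpha>), 1:] * shift c p\<close> minus that of
  \<open>pCons 0 p\<close>. It comes from writing the first product as the translate of
  \<open>[:c * (1 - \<alpha>), 1:] * p\<close>.\<close>

definition twist_coeff :: "complex \<Rightarrow> complex \<Rightarrow> complex poly \<Rightarrow> nat \<Rightarrow> complex"
  where "twist_coeff \<alpha> c p r = c * (1 - \<alpha>) * coeff p r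
    - of_nat (r + 1) * c * (coeff p r + c * (1 - \<alpha>) * coeff p (r + 1))
    + of_nat ((r + 1) * (r + 2)) / 2 * c ^ 2 * (coeff p (r + 1) + c * (1 - \<alpha>) * coeff p (r + 2))
    - of_nat ((r + 1) * (r + 2) * (r + 3)) / 6 * c ^ 3 * coeff p (r + 2)"

lemma coeff_twisted_shift:
  assumes "degree p \<le> r + 2"
  shows "coeff ([:- (c * \<alpha>), 1:] * shift c p) r = coeff (pCons 0 p) r + twist_coeff \<alpha> c p r"
proof -
  let ?q = "pCons 0 p + smult (c * (1 - \<alpha>)) p"
  have "[:- (c * \<alpha>), 1:] * shift c p = shift c ?q"
    by (simp add: shift_add shift_smult shift_pCons smult_add_left[symmetric] algebra_simps)
  moreover have "degree ?q \<le> r + 3"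
    using assms by (intro degree_add_le) (auto intro: order_trans[OF degree_pCons_le] order_trans[OF degree_smult_le])
  moreover have "coeff p (r + 3) = 0" using assms by (simp add: coeff_eq_0)
  ultimately show ?thesis
    using coeff_shift_top3[of ?q r c] by (simp add: twist_coeff_def eval_nat_numeral)
qed

text \<open>Here \<open>s\<close>, \<open>c1\<close>, \<open>c2\<close> stand for the top three
  coefficients of a polynomial \<open>R n 0\<close> of degree \<open>x + 2\<close>;
  \<open>b1\<close>, \<open>b2\<close> and \<open>d1\<close>, \<open>d2\<close> are the two below
  the top of \<open>R n 1\<close> and \<open>R n 2\<close>. Elimination cancels \<open>c1\<close>
  and \<open>c2\<close>, and \<open>s\<close> factors out.\<close>

lemma twisted_obstruction_algebra:
  fixes x \<alpha> s c1 c2 b1 b2 d1 d2 :: complex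
  assumes "(x + 3) * (b1 - c1) = - ((x + 2) * (x + 1 + 2 * \<alpha>) * s)"
    and "(x + 3) * (d1 - c1) = - (2 * (x + 2) * (x + 1 + 2 * \<alpha>) * s)"
    and "2 * (x + 2) * (b2 - c2) = - ((b1 + c1) * (x + 1) * (x + 2 * \<alpha>))"
    and "(x + 2) * (d2 - c2) = - ((d1 + c1) * (x + 1) * (x + 2 * \<alpha>))"
    and "2 * d2 = (2 - x) * b2 + x * c2 + (b1 - 3 * c1) * ((x + 1) * (x + 2 * \<alpha>) / 2)
      + s * (x + 2) * (x + 1) * (x + 3 * \<alpha>)"
    and "x + 1 \<noteq> 0" "x + 2 \<noteq> 0" "x + 3 \<noteq> 0" "s \<noteq> 0"
  shows "2 * \<alpha> * (x + 2)\<^sup>2 + (8 * \<alpha>\<^sup>2 - 2 * \<alpha> - 4) * (x + 2) + 16 * \<alpha>\<^sup>2 - 24 * \<alpha> + 8 = 0"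
proof -
  define \<tau> where "\<tau> = - ((x + 2) * (x + 1 + 2 * \<alpha>) / (x + 3))"
  have \<tau>: "(x + 3) * \<tau> = - ((x + 2) * (x + 1 + 2 * \<alpha>))" using assms(8) by (simp add: \<tau>_def)
  have "(x + 3) * (b1 - c1) = (x + 3) * (\<tau> * s)" "(x + 3) * (d1 - c1) = (x + 3) * (2 * \<tau> * s)"
    using assms(1,2) \<tau> by algebra+
  then have b1: "b1 = c1 + \<tau> * s" and d1: "d1 = c1 + 2 * \<tau> * s"
    using assms(8) by (simp_all add: diff_eq_eq add.commute)
  have "s * ((x + 1) * (\<tau> * (x + 2 * \<alpha>) * (x + 4) + (x + 2) * (x + 2) * (x + 3 * \<alpha>))) = 0"
    using assms(3,4,5) unfolding b1 d1 by algebra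
  then have "\<tau> * (x + 2 * \<alpha>) * (x + 4) + (x + 2) * (x + 2) * (x + 3 * \<alpha>) = 0"
    using assms(6,9) by simp
  then have "(x + 2) * (2 * \<alpha> * (x + 2)\<^sup>2 + (8 * \<alpha>\<^sup>2 - 2 * \<alpha> - 4) * (x + 2) + 16 * \<alpha>\<^sup>2 - 24 * \<alpha> + 8) = 0"
    using \<tau> by algebra
  then show ?thesis using assms(7) by simp
qed

text \<open>The relation \<open>step\<close> is the bracket of \<open>L i 0\<close> with
  \<open>L j n\<close> applied to 1, once the powers of \<open>lam\<close> are divided out.\<close>

locale twisted_family =
  fixes R :: "nat \<Rightarrow> int \<Rightarrow> complex poly" and \<alpha> :: complex
  assumes step: "smult (of_nat n) (R (n + 1) (i + j) - R (n + 1) j) =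
    smult (of_int i - of_int j) (R n (i + j)) + [:- (of_int i * \<alpha>), 1:] * shift (of_int i) (R n j)
      - [:- (of_int j + of_int i * \<alpha>), 1:] * R n j"
begin

lemma step0: "smult (of_nat n) (R (n + 1) k - R (n + 1) 0) =
    smult (of_int k) (R n k) + [:- (of_int k * \<alpha>), 1:] * (shift (of_int k) (R n 0) - R n 0)"
  using step[of n k 0] by (simp only: add_0_right of_int_0 diff_zero add_0_left ring_distribs) simp

text \<open>The left side of \<open>step\<close> telescopes: the passage from \<open>j\<close> to
  \<open>i + j\<close> is the one from 0 to \<open>i + j\<close> minus the one from 0 to
  \<open>j\<close>. This eliminates level \<open>n + 1\<close>.\<close>

lemma cocycle: "smult (2 * of_int j) (R n (i + j)) =
    [:- (of_int i * \<alpha>), 1:] * shift (of_int i) (R n j)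
    - [:- (2 * of_int j + of_int i * \<alpha>), 1:] * R n j
    - [:- (of_int (i + j) * \<alpha>), 1:] * (shift (of_int (i + j)) (R n 0) - R n 0)
    + [:- (of_int j * \<alpha>), 1:] * (shift (of_int j) (R n 0) - R n 0)"
proof (intro poly_eq_poly_eq_iff[THEN iffD1] ext)
  fix x
  have "poly (smult (of_nat n) (R (n + 1) (i + j) - R (n + 1) j)) x =
      poly (smult (of_nat n) (R (n + 1) (i + j) - R (n + 1) 0)) x
      - poly (smult (of_nat n) (R (n + 1) j - R (n + 1) 0)) x"
    by (simp add: algebra_simps)
  then show "poly (smult (2 * of_int j) (R n (i + j))) x = poly
    ([:- (of_int i * \<alpha>), 1:] * shift (of_int i) (R n j)
    - [:- (2 * of_int j + of_int i * \<alpha>), 1:] * R n j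
    - [:- (of_int (i + j) * \<alpha>), 1:] * (shift (of_int (i + j)) (R n 0) - R n 0)
    + [:- (of_int j * \<alpha>), 1:] * (shift (of_int j) (R n 0) - R n 0)) x"
    unfolding step step0 by (simp add: algebra_simps)
qed

lemma coeff_cocycle:
  assumes "degree (R n j) \<le> r + 2" "degree (R n 0) \<le> r + 2"
  shows "2 * of_int j * coeff (R n (i + j)) r =
    twist_coeff \<alpha> (of_int i) (R n j) r + (2 * of_int j + of_int i * \<alpha>) * coeff (R n j) r
    - (twist_coeff \<alpha> (of_int (i + j)) (R n 0) r + of_int (i + j) * \<alpha> * coeff (R n 0) r)
    + (twist_coeff \<alpha> (of_int j) (R n 0) r + of_int j * \<alpha> * coeff (R n 0) r)"
proof -
  have lin: "coeff ([:- c, 1:] * p) r = coeff (pCons 0 p) r - c * coeff p r" for c and p :: "complex poly"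
    using smult_1_left[of p] by simp
  have "2 * of_int j * coeff (R n (i + j)) r = coeff (smult (2 * of_int j) (R n (i + j))) r"
    by simp
  then show ?thesis
    unfolding cocycle right_diff_distrib[of "[:_, 1:]"] coeff_add coeff_diff coeff_twisted_shift[OF assms(1)]
      coeff_twisted_shift[OF assms(2)] lin[of _ "R n j"] lin[of _ "R n 0"]
    by simp
qed

text \<open>The choice \<open>i = - j\<close> brings in \<open>R n 0\<close> on the left, so only
  \<open>R n j\<close> and \<open>R n 0\<close> are compared.\<close>

lemma coeff_cocycle0:
  assumes "degree (R n j) \<le> r + 2" "degree (R n 0) \<le> r + 2"
  shows "2 * of_int j * coeff (R n 0) r =
    twist_coeff \<alpha> (- of_int j) (R n j) r + (2 - \<alpha>) * of_int j * coeff (R n j) r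
    + (twist_coeff \<alpha> (of_int j) (R n 0) r + of_int j * \<alpha> * coeff (R n 0) r)"
  using coeff_cocycle[OF assms, of "- j"] by (simp add: twist_coeff_def algebra_simps)

text \<open>If \<open>R n j\<close> had degree \<open>q\<close> above \<open>N\<close>, the relation
  at \<open>q\<close> would contain only its leading coefficient, with the nonzero factor
  \<open>j * (q + 2)\<close>.\<close>

lemma degree_R_le:
  assumes "degree (R n 0) \<le> N"
  shows "degree (R n j) \<le> N"
proof (rule ccontr)
  assume *: "\<not> degree (R n j) \<le> N"
  define q where "q = degree (R n j)"
  have "j \<noteq> 0" using assms * by auto
  have z: "coeff (R n j) (Suc q) = 0" "coeff (R n j) (Suc (Suc q)) = 0"
    "coeff (R n 0) q = 0" "coeff (R n 0) (Suc q) = 0" "coeff (R n 0) (Suc (Suc q)) = 0"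
    using * assms by (auto simp: q_def intro!: coeff_eq_0)
  have "of_int j * of_nat (Suc (Suc q)) * coeff (R n j) q = (0 :: complex)"
    using coeff_cocycle0[of n j q] z * assms by (simp add: twist_coeff_def q_def algebra_simps)
  then have "coeff (R n j) q = 0" using \<open>j \<noteq> 0\<close> by (simp del: of_nat_Suc)
  then show False using * by (auto simp: q_def)
qed

lemma coeff_top:
  assumes "degree (R n 0) \<le> N"
  shows "coeff (R n j) N = coeff (R n 0) N"
proof (cases "j = 0")
  case False
  have z: "coeff (R n j) (Suc N) = 0" "coeff (R n j) (Suc (Suc N)) = 0"
    "coeff (R n 0) (Suc N) = 0" "coeff (R n 0) (Suc (Suc N)) = 0"
    using degree_R_le[OF assms, of j] assms by (auto intro!: coeff_eq_0)
  have "of_int j * of_nat (Suc (Suc N)) * (coeff (R n j) N - coeff (R n 0) N) = (0 :: complex)"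
    using coeff_cocycle0[of n j N] degree_R_le[OF assms, of j] assms z
    by (simp add: twist_coeff_def algebra_simps)
  then show ?thesis using False by (simp del: of_nat_Suc)
qed simp

text \<open>The top coefficients agree by \<open>coeff_top\<close>, and the relation one degree
  lower is divisible by \<open>j\<close>; hence the second coefficient varies linearly in
  \<open>j\<close>.\<close>

lemma coeff_second:
  assumes "degree (R n 0) \<le> m + 1"
  shows "of_nat (m + 2) * (coeff (R n j) m - coeff (R n 0) m) =
    - of_int j * of_nat (m + 1) * (of_nat m + 2 * \<alpha>) * coeff (R n 0) (m + 1)"
proof (cases "j = 0")
  case False
  have z: "coeff (R n j) (m + 2) = 0" "coeff (R n 0) (m + 2) = 0"
    using degree_R_le[OF assms, of j] assms by (auto intro!: coeff_eq_0)
  have "of_int j * (of_nat (m + 2) * (coeff (R n j) m - coeff (R n 0) m)) =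
    of_int j * (- of_int j * of_nat (m + 1) * (of_nat m + 2 * \<alpha>) * coeff (R n 0) (m + 1))"
    using coeff_cocycle0[of n j m] degree_R_le[OF assms, of j] assms z coeff_top[OF assms, of j]
    by (simp add: twist_coeff_def) algebra
  moreover have "of_int j \<noteq> (0 :: complex)" using False by simp
  ultimately show ?thesis by (metis mult_left_cancel)
qed simp

lemma coeff_third:
  assumes "degree (R n 0) \<le> r + 2"
  shows "2 * of_nat (r + 2) * (coeff (R n j) r - coeff (R n 0) r) =
    - of_int j * (coeff (R n j) (r + 1) + coeff (R n 0) (r + 1)) * of_nat (r + 1) * (of_nat r + 2 * \<alpha>)"
proof (cases "j = 0")
  case False
  have "of_int j * (2 * of_nat (r + 2) * (coeff (R n j) r - coeff (R n 0) r)) =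
    of_int j * (- of_int j * (coeff (R n j) (r + 1) + coeff (R n 0) (r + 1)) * of_nat (r + 1) * (of_nat r + 2 * \<alpha>))"
    using coeff_cocycle0[of n j r] degree_R_le[OF assms, of j] assms coeff_top[OF assms, of j]
    by (simp add: twist_coeff_def) algebra
  moreover have "of_int j \<noteq> (0 :: complex)" using False by simp
  ultimately show ?thesis by (metis mult_left_cancel)
qed simp

text \<open>The cocycle relation at \<open>(i, j) = (- 1, 1)\<close> and \<open>(- 2, 2)\<close> already expresses the three leading
  coefficients of \<open>R n 1\<close> and \<open>R n 2\<close> through those of \<open>R n 0\<close>; at \<open>(1, 1)\<close> it then leaves a
  condition on \<open>\<alpha>\<close> and the degree alone.\<close>

lemma obstruction:
  assumes "degree (R n 0) = r + 2"
  shows "2 * \<alpha> * (of_nat r + 2)\<^sup>2 + (8 * \<alpha>\<^sup>2 - 2 * \<alpha> - 4) * (of_nat r + 2) + 16 * \<alpha>\<^sup>2 - 24 * \<alpha> + 8 = 0"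
proof -
  have deg: "degree (R n 0) \<le> r + 2" "degree (R n 0) \<le> Suc r + 1" using assms by simp_all
  have nz: "of_nat r + 1 \<noteq> (0 :: complex)" "of_nat r + 2 \<noteq> (0 :: complex)" "of_nat r + 3 \<noteq> (0 :: complex)"
    using of_nat_neq_0[of r, where 'a = complex] of_nat_neq_0[of "r + 1", where 'a = complex]
      of_nat_neq_0[of "r + 2", where 'a = complex] by (simp_all add: add.commute)
  have lead: "coeff (R n 0) (r + 2) \<noteq> 0"
  proof -
    have "R n 0 \<noteq> 0" using assms by auto
    then show ?thesis using assms leading_coeff_0_iff[of "R n 0"] by simp
  qed
  note second = coeff_second[OF deg(2)] and third = coeff_third[OF deg(1)]
  note top = coeff_top[OF deg(1), of 1]
  show ?thesis
  proof (rule twisted_obstruction_algebra[OF _ _ _ _ _ nz lead])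
    show "(of_nat r + 3) * (coeff (R n 1) (r + 1) - coeff (R n 0) (r + 1)) =
      - ((of_nat r + 2) * (of_nat r + 1 + 2 * \<alpha>) * coeff (R n 0) (r + 2))"
      using second[of 1] by (simp add: algebra_simps)
    show "(of_nat r + 3) * (coeff (R n 2) (r + 1) - coeff (R n 0) (r + 1)) =
      - (2 * (of_nat r + 2) * (of_nat r + 1 + 2 * \<alpha>) * coeff (R n 0) (r + 2))"
      using second[of 2] by (simp add: algebra_simps)
    show "2 * (of_nat r + 2) * (coeff (R n 1) r - coeff (R n 0) r) =
      - ((coeff (R n 1) (r + 1) + coeff (R n 0) (r + 1)) * (of_nat r + 1) * (of_nat r + 2 * \<alpha>))"
      using third[of 1] by (simp add: algebra_simps)
    show "(of_nat r + 2) * (coeff (R n 2) r - coeff (R n 0) r) =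
      - ((coeff (R n 2) (r + 1) + coeff (R n 0) (r + 1)) * (of_nat r + 1) * (of_nat r + 2 * \<alpha>))"
      using third[of 2] by (simp add: algebra_simps) algebra
    show "2 * coeff (R n 2) r = (2 - of_nat r) * coeff (R n 1) r + of_nat r * coeff (R n 0) r +
      (coeff (R n 1) (r + 1) - 3 * coeff (R n 0) (r + 1)) * ((of_nat r + 1) * (of_nat r + 2 * \<alpha>) / 2) +
      coeff (R n 0) (r + 2) * (of_nat r + 2) * (of_nat r + 1) * (of_nat r + 3 * \<alpha>)"
      using coeff_cocycle[of n 1 r 1] degree_R_le[OF deg(1), of 1] deg(1) top
      by (simp add: twist_coeff_def field_simps) algebra
  qed
qed

text \<open>The difference \<open>X\<close> has degree \<open>r + 2\<close> when computed from level
  \<open>n\<close>, and one less than the degree of \<open>R (n + 1) 0\<close> when computed at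
  level \<open>n + 1\<close>.\<close>

lemma degree_step:
  assumes n: "n \<ge> 1" and deg: "degree (R n 0) = r + 2"
  shows "degree (R (n + 1) 0) = r + 3"
proof -
  define X where "X = R (n + 1) 1 - R (n + 1) 0"
  have coeff_X: "of_nat n * coeff X d = coeff (R n 1) d + twist_coeff \<alpha> 1 (R n 0) d + \<alpha> * coeff (R n 0) d"
    if "r \<le> d" for d
  proof -
    have lin: "coeff ([:- c, 1:] * p) d = coeff (pCons 0 p) d - c * coeff p d" for c and p :: "complex poly"
      using smult_1_left[of p] by simp
    have "degree (R n 0) \<le> d + 2" using deg that by simp
    note tw = coeff_twisted_shift[OF this, of 1 \<alpha>]
    have "of_nat n * coeff X d = coeff (smult (of_nat n) (R (n + 1) 1 - R (n + 1) 0)) d"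
      by (simp add: X_def)
    then show ?thesis
      unfolding step0 right_diff_distrib[of "[:_, 1:]"] coeff_add coeff_diff lin
      using tw by simp
  qed
  have lead: "coeff (R n 0) (r + 2) \<noteq> 0"
  proof -
    have "R n 0 \<noteq> 0" using deg by auto
    then show ?thesis using deg leading_coeff_0_iff[of "R n 0"] by simp
  qed
  have "of_nat n * coeff X (r + 2) + of_nat (r + 1) * coeff (R n 0) (r + 2) = 0"
    using coeff_X[of "r + 2"] coeff_top[of n "r + 2" 1] deg
    by (simp add: twist_coeff_def coeff_eq_0 algebra_simps)
  then have "of_nat n * coeff X (r + 2) = - (of_nat (r + 1) * coeff (R n 0) (r + 2))"
    by (rule add_eq_0_iff2[THEN iffD1])
  also have "\<dots> \<noteq> 0" using lead by (simp del: of_nat_Suc)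
  finally have X_nz: "coeff X (r + 2) \<noteq> 0" by auto
  define M where "M = degree (R (n + 1) 0)"
  have "coeff X d = 0" if "M \<le> d" for d
    using coeff_top[of "n + 1" d 1] that by (simp add: X_def M_def)
  then have "r + 2 < M" using X_nz not_le by blast
  then obtain m where m: "M = m + 3" "r \<le> m"
    by (intro that[of "M - 3"]) simp_all
  have "degree (R (n + 1) 0) = (m + 1) + 2" using m by (simp add: M_def)
  note g = obstruction[OF this]
  have "of_nat (m + 4) * coeff X (m + 2) =
      - of_nat (m + 3) * (of_nat (m + 2) + 2 * \<alpha>) * coeff (R (n + 1) 0) (m + 3)"
    using coeff_second[of "n + 1" "m + 2" 1] m
    by (simp add: X_def M_def eval_nat_numeral algebra_simps)
  \<comment> \<open>At the exceptional \<open>\<alpha>\<close> the obstruction polynomial takes the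
    nonzero value \<open>(m + 3) * (m + 4) ^ 2\<close>.\<close>
  moreover have "of_nat (m + 2) + 2 * \<alpha> \<noteq> 0"
  proof
    assume "of_nat (m + 2) + 2 * \<alpha> = 0"
    then have "\<alpha> = - (of_nat m + 2) / 2" by (simp add: field_simps) algebra
    then have "(of_nat m + 3) * (of_nat m + 4)\<^sup>2 = (0 :: complex)"
      using g by (simp add: power2_eq_square field_simps) algebra
    moreover have "(of_nat m + 3) * (of_nat m + 4)\<^sup>2 = (of_nat ((m + 3) * (m + 4) ^ 2) :: complex)"
      by simp
    ultimately have "(of_nat ((m + 3) * (m + 4) ^ 2) :: complex) = 0" by (simp only:)
    then show False unfolding of_nat_eq_0_iff by simp
  qed
  moreover have "coeff (R (n + 1) 0) (m + 3) \<noteq> 0"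
  proof -
    have "R (n + 1) 0 \<noteq> 0" using m M_def by auto
    then show ?thesis using m M_def leading_coeff_0_iff[of "R (n + 1) 0"] by simp
  qed
  moreover have "of_nat (m + 3) \<noteq> (0 :: complex)" unfolding of_nat_eq_0_iff by simp
  ultimately have "of_nat (m + 4) * coeff X (m + 2) \<noteq> 0" by (simp del: of_nat_add)
  then have X_nz': "coeff X (m + 2) \<noteq> 0" by auto
  have "m = r"
  proof (rule ccontr)
    assume "m \<noteq> r"
    then have "r < m" using m by simp
    then have z: "coeff (R n 0) (m + 2) = 0" "coeff (R n 0) (m + 3) = 0" "coeff (R n 0) (m + 4) = 0"
      "coeff (R n 1) (m + 2) = 0"
      using deg degree_R_le[of n "r + 2" 1] by (auto intro!: coeff_eq_0)
    have "of_nat n * coeff X (m + 2) = 0"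
      using coeff_X[of "m + 2"] z m by (simp add: twist_coeff_def eval_nat_numeral)
    then show False using X_nz' n by simp
  qed
  then show ?thesis using m by (simp add: M_def)
qed

lemma degree_le_1:
  assumes n: "n \<ge> 1"
  shows "degree (R n 0) \<le> 1"
proof (rule ccontr)
  assume "\<not> degree (R n 0) \<le> 1"
  then have "degree (R n 0) = (degree (R n 0) - 2) + 2" by simp
  then obtain r where d0: "degree (R n 0) = r + 2" by blast
  have d1: "degree (R (n + 1) 0) = (r + 1) + 2" using degree_step[OF n d0] by simp
  have d2: "degree (R (n + 2) 0) = (r + 2) + 2" using degree_step[OF _ d1] by simp
  define x where "x = (of_nat r + 2 :: complex)"
  have g0: "2 * \<alpha> * x\<^sup>2 + (8 * \<alpha>\<^sup>2 - 2 * \<alpha> - 4) * x + 16 * \<alpha>\<^sup>2 - 24 * \<alpha> + 8 = 0"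
    using obstruction[OF d0] by (simp add: x_def)
  have g1: "2 * \<alpha> * (x + 1)\<^sup>2 + (8 * \<alpha>\<^sup>2 - 2 * \<alpha> - 4) * (x + 1) + 16 * \<alpha>\<^sup>2 - 24 * \<alpha> + 8 = 0"
    using obstruction[OF d1] by (simp add: x_def add_ac)
  have g2: "2 * \<alpha> * (x + 2)\<^sup>2 + (8 * \<alpha>\<^sup>2 - 2 * \<alpha> - 4) * (x + 2) + 16 * \<alpha>\<^sup>2 - 24 * \<alpha> + 8 = 0"
    using obstruction[OF d2] by (simp add: x_def add_ac)
  \<comment> \<open>The second difference of the quadratic in \<open>x\<close> is
    \<open>4 * \<alpha>\<close>.\<close>
  have "4 * \<alpha> = 0" using g0 g1 g2 by algebra
  then have "\<alpha> = 0" by simp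
  \<comment> \<open>For \<open>\<alpha> = 0\<close> the first two conditions read
    \<open>8 - 4 * x = 0\<close> and \<open>4 - 4 * x = 0\<close>.\<close>
  then show False using g0 g1 by simp
qed

lemma closed_form:
  assumes n: "n \<ge> 1"
  shows "R n k = smult (coeff (R n 0) 1) [:- (of_int k * \<alpha>), 1:]
    - [:of_nat n * \<alpha> * coeff (R (n + 1) 0) 1:]"
proof -
  have deg: "degree (R n 0) \<le> 1" "degree (R (n + 1) 0) \<le> 1" using degree_le_1 n by simp_all
  have second: "coeff (R m k) 0 = coeff (R m 0) 0 - of_int k * \<alpha> * coeff (R m 0) 1"
    if "degree (R m 0) \<le> 1" for m k
  proof -
    have "2 * (coeff (R m k) 0 - coeff (R m 0) 0) = 2 * (- of_int k * \<alpha> * coeff (R m 0) 1)"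
      using coeff_second[of m 0 k] that by simp
    then show ?thesis by algebra
  qed
  \<comment> \<open>This is the constant term of \<open>step0\<close> at \<open>k = 1\<close>; the
    two contributions \<open>\<alpha> * coeff (R n 0) 1\<close> cancel.\<close>
  have "coeff (R n 0) 0 = - of_nat n * \<alpha> * coeff (R (n + 1) 0) 1"
  proof -
    have form: "R n 0 = [:coeff (R n 0) 0, coeff (R n 0) 1:]"
      by (rule poly_eqI) (use deg in \<open>auto simp: coeff_pCons coeff_eq_0 split: nat.splits\<close>)
    have "coeff (smult (of_nat n) (R (n + 1) 1 - R (n + 1) 0)) 0 = coeff (R n 1) 0 +
      coeff ([:- \<alpha>, 1:] * (shift 1 (R n 0) - R n 0)) 0"
      unfolding step0 by simp
    also have "coeff ([:- \<alpha>, 1:] * (shift 1 (R n 0) - R n 0)) 0 = \<alpha> * coeff (R n 0) 1"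
      by (subst (1 2) form) (simp add: shift_pCons)
    finally show ?thesis using second[OF deg(1), of 1] second[OF deg(2), of 1]
      by (simp add: mult.assoc)
  qed
  then show ?thesis
    using second[OF deg(1), of k] coeff_top[OF deg(1), of k] degree_R_le[OF deg(1), of k]
    by (intro poly_eqI) (auto simp: coeff_pCons coeff_eq_0 split: nat.splits)
qed

end

section \<open>Determination of the action\<close>

lemma shift_1_invariant_const:
  assumes "shift 1 p = p"
  shows "\<exists>x. p = [:x:]"
proof (cases "degree p")
  case (Suc n)
  have "coeff (1 * (shift 1 p - p)) n = - of_nat (Suc n) * lead_coeff p"
    using coeff_mult_shift_diff[of 1 0 p "Suc n" n 1] Suc by simp
  then have "lead_coeff p = 0" using assms by (simp del: of_nat_Suc)
  then have "p = 0" by (rule leading_coeff_0_iff[THEN iffD1])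
  then show ?thesis using Suc by simp
qed (auto elim: degree_eq_zeroE)

text \<open>This matches the recurrence that the brackets impose for \<open>b = 1\<close>. In the
  proof, \<open>h\<close> is the homogeneous solution carrying the free constant, and
  \<open>S\<close> the particular solution that vanishes at level 1.\<close>

lemma \<phi>_scalar_Suc:
  assumes "m \<ge> 1"
  shows "of_nat m * \<phi>_scalar a i (Suc m) lam \<beta> \<gamma> \<kappa> =
    a * lam powi i * \<beta> ^ m * \<gamma> - (a + of_int i) * \<phi>_scalar a i m lam \<beta> \<gamma> \<kappa>"
proof -
  obtain n where m: "m = Suc n" using assms by (cases m) auto
  have fact_eq': "of_nat (Suc n) * (x / fact (Suc n) * y) = x / (fact n :: complex) * y" for x y
    by (simp add: fact_Suc del: of_nat_Suc)
  define h where "h k = (-1) ^ (k - 1) / fact (k - 1) * (a + of_int i) ^ (k - 1) * \<kappa>" for k :: nat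
  define S where "S k = (\<Sum>l<k - 1. fact (k - l - 2) / fact (k - 1) * (-1) ^ l * (a + of_int i) ^ l * a *
      lam powi i * \<beta> ^ (k - l - 1) * \<gamma>)" for k
  have \<phi>_eq: "\<phi>_scalar a i (Suc k) lam \<beta> \<gamma> \<kappa> = h (Suc k) + S (Suc k)" for k
    by (simp add: \<phi>_scalar_def h_def S_def)
  have "of_nat (Suc n) * h (Suc (Suc n)) = - ((a + of_int i) * h (Suc n))"
    unfolding h_def mult.assoc diff_Suc_1 fact_eq' by (simp add: mult_ac)
  moreover have "of_nat (Suc n) * S (Suc (Suc n)) =
      a * lam powi i * \<beta> ^ Suc n * \<gamma> - (a + of_int i) * S (Suc n)"
    \<comment> \<open>The term \<open>l = 0\<close> is the inhomogeneity; the others are those of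
      \<open>S (Suc n)\<close> multiplied by \<open>- (a + of_int i)\<close>.\<close>
    unfolding S_def sum_distrib_left mult.assoc diff_Suc_1 fact_eq' unfolding sum.lessThan_Suc_shift
    by (simp add: sum_negf[symmetric] mult_ac)
  ultimately show ?thesis
    unfolding m \<phi>_eq distrib_left by (simp only:) (simp add: algebra_simps)
qed

lemma \<psi>_scalar_Suc:
  assumes "m \<ge> 1"
  shows "of_nat m * \<psi>_scalar i (Suc m) \<gamma> \<kappa> = - of_int i * \<psi>_scalar i m \<gamma> \<kappa>"
proof -
  obtain n where "m = Suc n" using assms by (cases m) auto
  then show ?thesis by (simp add: \<psi>_scalar_def fact_Suc del: of_nat_Suc)
qed

locale rank_one_action =
  fixes a b :: complex and X :: "hv_index \<Rightarrow> complex poly \<Rightarrow> complex poly"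
  assumes add: "X u (p + q) = X u p + X u q"
    and smult: "X u (smult c p) = smult c (X u p)"
    and L00: "X (L 0 0) p = [:0, 1:] * p"
    and LL: "X (L i m) (X (L j n) p) - X (L j n) (X (L i m) p) =
      smult (of_int j - of_int i) (X (L (i + j) (m + n)) p)
      + smult (of_nat n - of_nat m) (X (L (i + j) (m + n + 1)) p)"
    and LH: "X (L i m) (X (H j n) p) - X (H j n) (X (L i m) p) =
      smult (a + of_int j + b * of_int i) (X (H (i + j) (m + n)) p)
      + smult (of_nat n + b * of_nat m) (X (H (i + j) (m + n + 1)) p)"
    and HH: "X (H i m) (X (H j n) p) = X (H j n) (X (H i m) p)"
begin

lemma L_mult_X: "X (L j n) ([:0, 1:] * p) = [:- of_int j, 1:] * X (L j n) p - smult (of_nat n) (X (L j (n + 1)) p)"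
  using LL[of 0 0 j n p] unfolding L00 by (simp add: algebra_simps)

lemma H_mult_X: "X (H j n) ([:0, 1:] * p) =
    [:- (a + of_int j), 1:] * X (H j n) p - smult (of_nat n) (X (H j (n + 1)) p)"
  using LH[of 0 0 j n p] unfolding L00 by (simp add: algebra_simps smult_add_left smult_diff_left)

lemma L_expansion: "X (L i m) f =
    (\<Sum>s\<le>degree f. smult ((- of_nat m) gchoose s) (X (L i (m + s)) 1 * shifted_deriv s (of_int i) f))"
  by (rule shift_derivation_expansion) (rule add smult L_mult_X)+

lemma H_expansion: "X (H i m) f =
    (\<Sum>s\<le>degree f. smult ((- of_nat m) gchoose s) (X (H i (m + s)) 1 * shifted_deriv s (a + of_int i) f))"
  by (rule shift_derivation_expansion) (rule add smult H_mult_X)+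

text \<open>At level 0 only the term without derivatives survives, so these operators are a
  translation followed by a multiplication.\<close>

lemma gchoose_0_sum: "(\<Sum>s\<le>n. smult ((- of_nat 0 :: complex) gchoose s) (f s)) = f 0"
proof -
  have "(\<Sum>s\<le>n. smult ((- of_nat 0 :: complex) gchoose s) (f s)) =
      (\<Sum>s\<in>{0}. smult ((- of_nat 0 :: complex) gchoose s) (f s))"
    by (rule sum.mono_neutral_right) (auto simp: gbinomial_0_left)
  then show ?thesis by simp
qed

lemma L_level0: "X (L i 0) f = X (L i 0) 1 * shift (of_int i) f"
  by (subst L_expansion, subst gchoose_0_sum) (simp add: shifted_deriv_def shift_def)

lemma H_level0: "X (H i 0) f = X (H i 0) 1 * shift (a + of_int i) f"
  by (subst H_expansion, subst gchoose_0_sum) (simp add: shifted_deriv_def shift_def)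

lemma X_const: "X u [:x:] = smult x (X u 1)"
  using smult[of u x 1] by simp

lemma L_linear: "X (L j n) [:x, y:] = smult x (X (L j n) 1)
    + smult y ([:- of_int j, 1:] * X (L j n) 1 - smult (of_nat n) (X (L j (n + 1)) 1))"
proof -
  have "[:x, y:] = [:x:] + smult y ([:0, 1:] * 1)" by simp
  then show ?thesis by (simp only: add smult L_mult_X X_const)
qed

lemma H_linear: "X (H j n) [:x, y:] = smult x (X (H j n) 1)
    + smult y ([:- (a + of_int j), 1:] * X (H j n) 1 - smult (of_nat n) (X (H j (n + 1)) 1))"
proof -
  have "[:x, y:] = [:x:] + smult y ([:0, 1:] * 1)" by simp
  then show ?thesis by (simp only: add smult H_mult_X X_const)
qed

lemma L_level0_form:
  obtains lam \<alpha> where "lam \<noteq> 0" "\<And>i. X (L i 0) 1 = smult (lam powi i) [:- (of_int i * \<alpha>), 1:]"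
proof (rule witt_rank_one[of "\<lambda>i. X (L i 0) 1"])
  show "X (L 0 0) 1 = [:0, 1:]" by (simp add: L00)
  show "X (L i 0) 1 * shift (of_int i) (X (L j 0) 1) - X (L j 0) 1 * shift (of_int j) (X (L i 0) 1) =
      smult (of_int j - of_int i) (X (L (i + j) 0) 1)" for i j
    using LL[of i 0 j 0 1] L_level0[of i "X (L j 0) 1"] L_level0[of j "X (L i 0) 1"] by simp
qed (rule that)

end

section \<open>The action of the elements \<open>L i m\<close>\<close>

locale rank_one_action_normalized = rank_one_action +
  fixes lam \<alpha> :: complex
  assumes lam: "lam \<noteq> 0" and L0: "X (L i 0) 1 = smult (lam powi i) [:- (of_int i * \<alpha>), 1:]"
begin

text \<open>Dividing by \<open>lam powi k\<close> frees the relations between different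
  \<open>k\<close> from \<open>lam\<close>; only \<open>\<alpha>\<close> remains.\<close>

definition R :: "nat \<Rightarrow> int \<Rightarrow> complex poly"
  where "R n k = smult (lam powi (- k)) (X (L k n) 1)"

lemma L_eq_R: "X (L k n) 1 = smult (lam powi k) (R n k)"
  using lam by (simp add: R_def power_int_minus)

lemma lam_powi_add: "lam powi (i + j) = lam powi i * lam powi j"
  using lam by (simp add: power_int_add)

sublocale twisted_family R \<alpha>
proof
  fix n i j
  show "smult (of_nat n) (R (n + 1) (i + j) - R (n + 1) j) =
    smult (of_int i - of_int j) (R n (i + j)) + [:- (of_int i * \<alpha>), 1:] * shift (of_int i) (R n j)
      - [:- (of_int j + of_int i * \<alpha>), 1:] * R n j" (is "?l = ?r")
  proof (intro poly_eq_poly_eq_iff[THEN iffD1] ext)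
    fix x
    have "X (L i 0) (X (L j n) 1) = smult (lam powi (i + j)) ([:- (of_int i * \<alpha>), 1:] * shift (of_int i) (R n j))"
      by (subst L_level0) (simp add: L0 L_eq_R[of j n] lam_powi_add shift_smult smult_diff_right mult_ac)
    moreover have "X (L j n) (X (L i 0) 1) = smult (lam powi (i + j)) (smult (- (of_int i * \<alpha>)) (R n j)
        + [:- of_int j, 1:] * R n j - smult (of_nat n) (R (n + 1) j))"
      unfolding L0 smult L_linear L_eq_R[of j]
      by (intro poly_eq_poly_eq_iff[THEN iffD1] ext) (simp add: lam_powi_add algebra_simps)
    ultimately have "smult (lam powi (i + j)) ([:- (of_int i * \<alpha>), 1:] * shift (of_int i) (R n j))
       - smult (lam powi (i + j)) (smult (- (of_int i * \<alpha>)) (R n j)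
          + [:- of_int j, 1:] * R n j - smult (of_nat n) (R (n + 1) j)) =
       smult (of_int j - of_int i) (smult (lam powi (i + j)) (R n (i + j)))
       + smult (of_nat n) (smult (lam powi (i + j)) (R (n + 1) (i + j)))"
      using LL[of i 0 j n 1] unfolding L_eq_R[of "i + j"] by simp
    then have "lam powi (i + j) * poly ?l x = lam powi (i + j) * poly ?r x"
      by (auto dest!: arg_cong[where f = "\<lambda>p. poly p x"] simp: algebra_simps)
    then show "poly ?l x = poly ?r x" using lam by simp
  qed
qed

definition s :: "nat \<Rightarrow> complex"
  where "s n = coeff (R n 0) 1"

lemma L_form: "X (L k n) 1 = smult (lam powi k) [:- (s n * of_int k * \<alpha>) - of_nat n * \<alpha> * s (n + 1), s n:]"
proof (cases "n = 0")
  case True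
  have "s 0 = 1" by (simp add: s_def R_def L0)
  then show ?thesis using True by (simp add: L0)
next
  case False
  then show ?thesis unfolding L_eq_R using closed_form[of n k] by (simp add: s_def)
qed

text \<open>Compare the coefficients of the variable in the bracket of \<open>L 0 m\<close> with
  \<open>L j n\<close>. After division by \<open>lam powi j\<close> both sides are affine in
  \<open>j\<close>, and equality of the slopes is the claim.\<close>

lemma s_mult: "s (m + n) = s m * s n"
proof -
  have *: "of_int j * (s m * s n) + (of_nat n * s (n + 1) * s m - of_nat m * s (m + 1) * s n) =
      of_int j * s (m + n) + (of_nat n - of_nat m) * s (m + n + 1)" for j
  proof -
    let ?l = "lam powi j"
    have "coeff (X (L 0 m) (X (L j n) 1) - X (L j n) (X (L 0 m) 1)) 1 =
      coeff (smult (of_int j) (X (L j (m + n)) 1) + smult (of_nat n - of_nat m) (X (L j (m + n + 1)) 1)) 1"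
      unfolding LL by simp
    then have "?l * (of_int j * (s m * s n) + (of_nat n * s (n + 1) * s m - of_nat m * s (m + 1) * s n)) =
      ?l * (of_int j * s (m + n) + (of_nat n - of_nat m) * s (m + n + 1))"
      unfolding L_form[of _ n] L_form[of _ m] smult L_linear L_form
      by (simp add: algebra_simps)
    then show ?thesis using lam by simp
  qed
  show ?thesis using *[of 0] *[of 1] by simp
qed

definition \<beta> :: complex
  where "\<beta> = s 1"

lemma s_power: "s n = \<beta> ^ n"
proof (induction n)
  case 0
  show ?case by (simp add: s_def R_def L0)
next
  case (Suc n)
  then show ?case using s_mult[of n 1] by (simp add: \<beta>_def)
qed

lemma L_form': "X (L k n) 1 = smult (lam powi k * \<beta> ^ n) [:- (of_int k * \<alpha>) - of_nat n * \<alpha> * \<beta>, 1:]"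
  unfolding L_form s_power by (simp add: algebra_simps)

lemma L_action: "X (L i m) f = \<Omega>_basis a b lam \<alpha> \<beta> \<gamma> \<kappa> (L i m) f"
  unfolding L_expansion[of i m f] L_form' \<Omega>_basis.simps
  by (intro sum.cong refl) (simp only: mult_smult_left smult_smult mult.assoc)

section \<open>The action of the elements \<open>H i m\<close>\<close>

definition G :: "int \<Rightarrow> nat \<Rightarrow> complex poly"
  where "G j n = X (H j n) 1"

lemma LH_level0: "smult (lam powi i) ([:- (of_int i * \<alpha>), 1:] * shift (of_int i) (G j n)
      - [:- (a + of_int j + of_int i * \<alpha>), 1:] * G j n + smult (of_nat n) (G j (n + 1))) =
    smult (a + of_int j + b * of_int i) (G (i + j) n) + smult (of_nat n) (G (i + j) (n + 1))"
proof -
  have "X (L i 0) (G j n) = smult (lam powi i) ([:- (of_int i * \<alpha>), 1:] * shift (of_int i) (G j n))"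
    by (subst L_level0) (simp add: L0 smult_diff_right mult_ac)
  moreover have "X (H j n) (X (L i 0) 1) = smult (lam powi i)
      ([:- (a + of_int j + of_int i * \<alpha>), 1:] * G j n - smult (of_nat n) (G j (n + 1)))"
    unfolding L0 smult H_linear G_def
    by (intro poly_eq_poly_eq_iff[THEN iffD1] ext) (simp add: algebra_simps)
  ultimately have "smult (lam powi i) ([:- (of_int i * \<alpha>), 1:] * shift (of_int i) (G j n)
      - [:- (a + of_int j + of_int i * \<alpha>), 1:] * G j n + smult (of_nat n) (G j (n + 1))) =
    X (L i 0) (X (H j n) 1) - X (H j n) (X (L i 0) 1)"
    by (simp only: G_def smult_diff_right smult_add_right) simp
  then show ?thesis
    using LH[of i 0 j n 1] by (simp add: G_def)
qed

lemma coeff_LH_level0: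
  assumes "degree (G j 0) \<le> n"
  shows "(a + of_int j + b * of_int i) * coeff (G (i + j) 0) n =
    lam powi i * (a + of_int j - of_int i * of_nat n) * coeff (G j 0) n"
proof -
  have "X (L i 0) 1 * shift (of_int i) (G j 0) - G j 0 * shift (a + of_int j) (X (L i 0) 1) =
      smult (a + of_int j + b * of_int i) (G (i + j) 0)"
    using LH[of i 0 j 0 1] L_level0[of i "X (H j 0) 1"] H_level0[of j "X (L i 0) 1"] by (simp add: G_def)
  moreover have "degree (X (L i 0) 1) \<le> 1" "coeff (X (L i 0) 1) 1 = lam powi i" by (simp_all add: L0)
  ultimately show ?thesis
    using coeff_shift_commutator[OF _ assms, of "X (L i 0) 1" 1 n "of_int i" "a + of_int j"]
    by (simp add: mult_ac)
qed

text \<open>A positive degree \<open>d\<close> at \<open>j\<close> would recur at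
  \<open>i + j\<close> for some nonzero \<open>i\<close>. The coefficient at
  \<open>2 * d - 1\<close> of the commutation of the two operators is then a nonzero multiple of
  \<open>i * d\<close>.\<close>

lemma degree_G_level0: "degree (G j 0) = 0"
proof (rule ccontr)
  define d where "d = degree (G j 0)"
  assume "degree (G j 0) \<noteq> 0"
  then have d: "d \<noteq> 0" and lead: "coeff (G j 0) d \<noteq> 0" by (auto simp: d_def)
  \<comment> \<open>At most one of the values 1 and 2 violates the second condition, which keeps the
    coefficient at \<open>d\<close> nonzero on passing from \<open>j\<close> to
    \<open>i + j\<close>.\<close>
  obtain i :: int where i: "i \<noteq> 0" "a + of_int j - of_int i * of_nat d \<noteq> 0"
  proof (cases "a + of_int j - of_nat d = 0")
    case True
    then have "a + of_int j - of_int 2 * of_nat d \<noteq> 0" using d by auto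
    then show thesis by (intro that[of 2]) simp_all
  qed (use that[of 1] in simp)
  define e where "e = degree (G (i + j) 0)"
  have nz: "a + of_int j + b * of_int i \<noteq> 0" "coeff (G (i + j) 0) d \<noteq> 0"
    using coeff_LH_level0[of j d i] i lead lam by (auto simp: d_def)
  then have "d \<le> e" unfolding e_def by (intro le_degree)
  have lead': "coeff (G (i + j) 0) e \<noteq> 0" using nz(2) by (auto simp: e_def)
  have "e = d"
  proof (rule ccontr)
    assume "e \<noteq> d"
    then have "coeff (G j 0) e = 0" using \<open>d \<le> e\<close> by (intro coeff_eq_0) (simp add: d_def)
    then show False using coeff_LH_level0[of j e i] \<open>d \<le> e\<close> nz(1) lead' by (simp add: d_def)
  qed
  obtain c where c: "d + d = Suc c" using d by (cases d) auto
  have "G j 0 * shift (a + of_int j) (G (i + j) 0) = G (i + j) 0 * shift (a + of_int (i + j)) (G j 0)"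
    using HH[of j 0 "i + j" 0 1] H_level0[of j "X (H (i + j) 0) 1"] H_level0[of "i + j" "X (H j 0) 1"]
    by (simp add: G_def)
  then have "((a + of_int (i + j)) * of_nat d - (a + of_int j) * of_nat d) *
      coeff (G j 0) d * coeff (G (i + j) 0) d = 0"
    using coeff_shift_commutator[of "G j 0" d "G (i + j) 0" d c "a + of_int j" "a + of_int (i + j)"]
      c \<open>e = d\<close> by (simp add: d_def e_def)
  then have "of_int i * of_nat d = (0 :: complex)" using lead nz(2) by (simp add: algebra_simps)
  then show False using i d by simp
qed

definition g :: "int \<Rightarrow> complex"
  where "g j = coeff (G j 0) 0"

lemma G_level0: "G j 0 = [:g j:]"
  using degree_G_level0[of j] by (auto simp: g_def elim: degree_eq_zeroE)

lemma g_step: "(a + of_int j) * lam powi i * g j = (a + of_int j + b * of_int i) * g (i + j)"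
  using coeff_LH_level0[of j 0 i] by (simp add: degree_G_level0 g_def mult_ac)

text \<open>The bracket of \<open>L\<^bsub>i,m\<^esub>\<close> with \<open>H\<^bsub>j,0\<^esub>\<close>, applied to \<open>1\<close>: its left-hand side involves only
  operators that are already known.\<close>

lemma G_recurrence: "[:(a + of_int j) * lam powi i * \<beta> ^ m * g j:] =
    smult (a + of_int j + b * of_int i) (G (i + j) m) + smult (b * of_nat m) (G (i + j) (m + 1))"
proof -
  have "X (L i m) (G j 0) = smult (g j) (X (L i m) 1)" by (simp add: G_level0 X_const)
  moreover have "X (H j 0) (X (L i m) 1) = smult (g j) (shift (a + of_int j) (X (L i m) 1))"
    using H_level0[of j "X (L i m) 1"] G_level0[of j] by (simp add: G_def)
  moreover have "X (L i m) 1 - shift (a + of_int j) (X (L i m) 1) = [:(a + of_int j) * lam powi i * \<beta> ^ m:]"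
    unfolding L_form' by (simp add: shift_smult shift_pCons algebra_simps)
  ultimately show ?thesis
    using LH[of i m j 0 1] by (simp add: G_def smult_diff_right[symmetric] mult_ac)
qed

lemma H_action:
  assumes "\<And>i m. G i m = [:c i m:]"
    and "\<And>i m. c i m = (if b = 0 then lam powi i * \<beta> ^ m * \<gamma>
      else if b = 1 \<and> a \<noteq> 0 then \<phi>_scalar a i m lam \<beta> \<gamma> (\<kappa> i)
      else if b = 1 \<and> a = 0 then \<psi>_scalar i m \<gamma> (\<kappa> i) else 0)"
  shows "X (H i m) f = \<Omega>_basis a b lam \<alpha> \<beta> \<gamma> \<kappa> (H i m) f"
proof -
  have "X (H i m) f = (\<Sum>s\<le>degree f. smult (((- of_nat m) gchoose s) * c i (m + s))
      (shifted_deriv s (a + of_int i) f))"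
    unfolding H_expansion[of i m f] G_def[symmetric] assms(1)
    by (intro sum.cong refl) simp
  then show ?thesis
    unfolding assms(2) \<Omega>_basis.simps by (auto simp: mult.assoc intro!: sum.cong)
qed

text \<open>For \<open>b = 0\<close> level \<open>m + 1\<close> drops out of
  \<open>G_recurrence\<close>, which then gives every value from one base index \<open>j\<close>
  with \<open>a + of_int j\<close> invertible.\<close>

lemma H_form_b_0:
  assumes "b = 0"
  shows "\<exists>\<gamma>. \<forall>i m. G i m = [:lam powi i * \<beta> ^ m * \<gamma>:]"
proof -
  obtain j where j: "a + of_int j \<noteq> 0"
    by (cases "a = 0") (use that[of 0] that[of 1] in auto)
  have "G i m = [:lam powi i * \<beta> ^ m * (lam powi (- j) * g j):]" for i m
  proof -
    have "smult (a + of_int j) (G i m) =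
        smult (a + of_int j) [:lam powi i * \<beta> ^ m * (lam powi (- j) * g j):]"
      using G_recurrence[of j "i - j" m] assms lam
      by (simp add: power_int_diff power_int_minus field_simps)
    then show ?thesis using j by (simp add: smult_cancel)
  qed
  then show ?thesis by blast
qed

text \<open>The level-zero constants vanish first. Then \<open>G_recurrence\<close> has zero on its
  left side for every way of splitting the index \<open>i\<close>, and two splittings differ by
  \<open>(b - 1)\<close> times \<open>G i m\<close>.\<close>

lemma H_form_b_generic:
  assumes "b \<noteq> 0" "b \<noteq> 1"
  shows "G i m = [:0:]"
proof -
  have g_0: "g j = 0" for j
  proof -
    \<comment> \<open>Going from \<open>j\<close> to \<open>j + 1\<close> and back gives two
      products of factors that differ by \<open>b * (1 - b)\<close>.\<close>
    have "(a + of_int j) * lam * g j = (a + of_int j + b) * g (j + 1)"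
      "(a + of_int j + 1) * g (j + 1) = lam * ((a + of_int j + 1 - b) * g j)"
      using g_step[of j 1] g_step[of "j + 1" "- 1"] lam
      by (simp_all add: power_int_minus field_simps)
    then have "lam * (b * (1 - b)) * g j = 0" by algebra
    then show ?thesis using assms lam by simp
  qed
  have eq: "smult (a + of_int (m' - k) + b * of_int k) (G m' m) + smult (b * of_nat m) (G m' (m + 1)) = 0"
    for m' k
    using G_recurrence[of "m' - k" k m] g_0 by simp
  have "smult (b - 1) (G i m) = (smult (a + of_int (i - 1) + b * of_int 1) (G i m) + p)
      - (smult (a + of_int (i - 0) + b * of_int 0) (G i m) + p)" for p
    by (simp add: smult_add_left smult_diff_left)
  from this[of "smult (b * of_nat m) (G i (m + 1))"] have "smult (b - 1) (G i m) = 0"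
    unfolding eq by simp
  then show ?thesis using assms by simp
qed

lemma G_recurrence_b_1:
  assumes "b = 1"
  shows "smult (of_nat m) (G k (m + 1)) = [:a * lam powi k * \<beta> ^ m * g 0:] - smult (a + of_int k) (G k m)"
  using G_recurrence[of 0 k m] assms by (simp add: algebra_simps)

text \<open>Eliminating level 2 from the bracket with \<open>L 1 0\<close> leaves a linear factor
  times \<open>shift 1 (G j 1) - G j 1\<close>, and the linear factor can be cancelled.\<close>

lemma G_level1_const:
  assumes "b = 1"
  shows "\<exists>x. G j 1 = [:x:]"
proof (rule shift_1_invariant_const)
  let ?c = "lam powi j * a * \<beta> * g 0"
  have rec: "G k 2 = [:a * lam powi k * \<beta> * g 0:] - smult (a + of_int k) (G k 1)" for k
    using G_recurrence_b_1[OF assms, of 1 k] by (simp add: numeral_2_eq_2)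
  have "[:- \<alpha>, 1:] * (shift 1 (G j 1) - G j 1) = 0"
  proof (intro poly_eq_poly_eq_iff[THEN iffD1] ext)
    fix x
    have "poly (smult (lam powi 1) ([:- (of_int 1 * \<alpha>), 1:] * shift (of_int 1) (G j 1)
      - [:- (a + of_int j + of_int 1 * \<alpha>), 1:] * G j 1 + smult (of_nat 1) (G j (1 + 1)))) x =
      poly (smult (a + of_int j + b * of_int 1) (G (1 + j) 1) + smult (of_nat 1) (G (1 + j) (1 + 1))) x"
      unfolding LH_level0 ..
    then have "lam * poly ([:- \<alpha>, 1:] * (shift 1 (G j 1) - G j 1)) x = 0"
      using lam assms 
        by (simp add: rec numeral_2_eq_2[symmetric] lam_powi_add del: mult_eq_0_iff) algebra
    then show "poly ([:- \<alpha>, 1:] * (shift 1 (G j 1) - G j 1)) x = poly 0 x" using lam by simp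
  qed
  then have "[:- \<alpha>, 1:] = 0 \<or> shift 1 (G j 1) - G j 1 = 0" by (simp only: mult_eq_0_iff)
  then show "shift 1 (G j 1) = G j 1" by simp
qed

text \<open>\<open>\<gamma>\<close> is \<open>g 0\<close>, and \<open>\<kappa> i\<close> is the
  constant at level 1, which the recurrence leaves free because its factor \<open>m\<close> is zero
  at \<open>m = 0\<close>. Higher levels follow by division by \<open>m\<close>.\<close>

lemma H_form_b_1:
  assumes b: "b = 1" and "\<And>k. a \<noteq> 0 \<Longrightarrow> a + of_int k \<noteq> 0"
  shows "\<exists>\<gamma> \<kappa>. \<forall>i m. G i m = [:if a \<noteq> 0 then \<phi>_scalar a i m lam \<beta> \<gamma> (\<kappa> i) else \<psi>_scalar i m \<gamma> (\<kappa> i):]"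
proof -
  define \<kappa> where "\<kappa> i = coeff (G i 1) 0" for i
  have G1: "G i 1 = [:\<kappa> i:]" for i
    using G_level1_const[OF b, of i] by (auto simp: \<kappa>_def)
  have g0: "a * lam powi i * g 0 = (a + of_int i) * g i" for i
    using g_step[of 0 i] b by simp
  let ?c = "\<lambda>i m. if a \<noteq> 0 then \<phi>_scalar a i m lam \<beta> (g 0) (\<kappa> i) else \<psi>_scalar i m (g 0) (\<kappa> i)"
  have "G i m = [:?c i m:]" for i m
  proof (induction m)
    case 0
    \<comment> \<open>For \<open>a = 0\<close> the relation \<open>g0\<close> makes
      \<open>g i\<close> vanish unless \<open>i = 0\<close>; otherwise it is solved for
      \<open>g i\<close>.\<close>
    show ?case
      using g0[of i] assms(2)[of i] by (auto simp: G_level0 \<phi>_scalar_def \<psi>_scalar_def field_simps)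
  next
    case (Suc m)
    show ?case
    proof (cases "m = 0")
      case True
      then show ?thesis using G1[of i] by (simp add: \<phi>_scalar_def \<psi>_scalar_def)
    next
      case False
      have "smult (of_nat m) (G i (Suc m)) = smult (of_nat m) [:?c i (Suc m):]"
        using G_recurrence_b_1[OF b, of m i] Suc.IH False
          \<phi>_scalar_Suc[of m a i lam \<beta> "g 0" "\<kappa> i"] \<psi>_scalar_Suc[of m i "g 0" "\<kappa> i"]
        by (cases "a = 0") simp_all
      moreover have "of_nat m \<noteq> (0 :: complex)" using False by simp
      ultimately show ?thesis by (metis smult_cancel)
    qed
  qed
  then show ?thesis by blast
qed

theorem action_eq_\<Omega>:
  assumes "\<And>k. a \<noteq> 0 \<Longrightarrow> a + of_int k \<noteq> 0"
  shows "\<exists>\<gamma> \<kappa>. \<forall>u f. X u f = \<Omega>_basis a b lam \<alpha> \<beta> \<gamma> \<kappa> u f"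
proof -
  have "\<exists>c \<gamma> \<kappa>. (\<forall>i m. G i m = [:c i m:]) \<and> (\<forall>i m. c i m = (if b = 0 then lam powi i * \<beta> ^ m * \<gamma>
      else if b = 1 \<and> a \<noteq> 0 then \<phi>_scalar a i m lam \<beta> \<gamma> (\<kappa> i)
      else if b = 1 \<and> a = 0 then \<psi>_scalar i m \<gamma> (\<kappa> i) else 0))"
  proof -
    consider "b = 0" | "b = 1" | "b \<noteq> 0" "b \<noteq> 1" by blast
    then show ?thesis
    proof cases
      case 1
      then show ?thesis using H_form_b_0 by auto
    next
      case 2
      obtain \<gamma> \<kappa> where "\<And>i m. G i m =
          [:if a \<noteq> 0 then \<phi>_scalar a i m lam \<beta> \<gamma> (\<kappa> i) else \<psi>_scalar i m \<gamma> (\<kappa> i):]"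
        using H_form_b_1[OF 2 assms] by blast
      with 2 show ?thesis
        by (intro exI[of _ "\<lambda>i m. if a \<noteq> 0 then \<phi>_scalar a i m lam \<beta> \<gamma> (\<kappa> i) else \<psi>_scalar i m \<gamma> (\<kappa> i)"]
            exI[of _ \<gamma>] exI[of _ \<kappa>]) simp
    next
      case 3
      then show ?thesis using H_form_b_generic by (intro exI[of _ "\<lambda>_ _. 0"]) simp
    qed
  qed
  then obtain c \<gamma> \<kappa> where c: "\<And>i m. G i m = [:c i m:]"
    "\<And>i m. c i m = (if b = 0 then lam powi i * \<beta> ^ m * \<gamma>
      else if b = 1 \<and> a \<noteq> 0 then \<phi>_scalar a i m lam \<beta> \<gamma> (\<kappa> i)
      else if b = 1 \<and> a = 0 then \<psi>_scalar i m \<gamma> (\<kappa> i) else 0)"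
    by blast
  have "X u f = \<Omega>_basis a b lam \<alpha> \<beta> \<gamma> \<kappa> u f" for u f
    using L_action H_action[OF c] by (cases u) simp_all
  then show ?thesis by blast
qed

end

section \<open>Transport to polynomials\<close>

text \<open>The module axioms for \<open>act'\<close> are carried along the bijection, so the
  formulas of \<open>\<Omega>\<close> need not be checked against the brackets.\<close>

lemma lie_module_isomorphicI:
  assumes "lie_module scale bracket mscale act" and "Vector_Spaces.linear mscale mscale' \<phi>" and "bij \<phi>"
    and equivariant: "\<And>x v. \<phi> (act x v) = act' x (\<phi> v)"
  shows "lie_module_isomorphic scale bracket mscale act mscale' act'"
proof -
  interpret M: lie_module scale bracket mscale act by fact
  interpret \<phi>: Vector_Spaces.linear mscale mscale' \<phi> by fact
  interpret l: Vector_Spaces.linear scale mscale "\<lambda>x. act x v" for v by (rule M.act_linear_left)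
  interpret r: Vector_Spaces.linear mscale mscale "act x" for x by (rule M.act_linear_right)
  have surj: "\<exists>v. w = \<phi> v" for w using \<open>bij \<phi>\<close> by (metis bij_pointE)
  have "lie_module scale bracket mscale' act'"
  proof unfold_locales
    fix x y c w w'
    obtain v v' where w: "w = \<phi> v" "w' = \<phi> v'" using surj by blast
    show "act' (x + y) w = act' x w + act' y w" "act' (scale c x) w = mscale' c (act' x w)"
      "act' x (w + w') = act' x w + act' x w'" "act' x (mscale' c w) = mscale' c (act' x w)"
      "act' (bracket x y) w = act' x (act' y w) - act' y (act' x w)"
      unfolding w
      by (simp_all flip: equivariant \<phi>.add \<phi>.scale \<phi>.diff add: l.add l.scale r.add r.scale M.act_bracket)
  qed
  then show ?thesis
    unfolding lie_module_isomorphic_def using assms by blast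
qed

lemma act_eq_linear_extension:
  assumes "lie_module hv_scale (hv_bracket a b) mscale act"
  shows "act x v = linear_extension mscale (\<lambda>u. act (Poly_Mapping.single u 1) v) x"
proof -
  interpret M: lie_module hv_scale "hv_bracket a b" mscale act by fact
  interpret l: Vector_Spaces.linear hv_scale mscale "\<lambda>x. act x v" by (rule M.act_linear_left)
  interpret e: Vector_Spaces.linear hv_scale mscale "linear_extension mscale (\<lambda>u. act (Poly_Mapping.single u 1) v)"
    by (rule linear_linear_extension) (rule l.vs2.vector_space_axioms)
  show ?thesis
  proof (induction x rule: hv_induct)
    case (single u c)
    show ?case
      using l.scale[of c "Poly_Mapping.single u 1"] l.vs2.vector_space_axioms by simp
  qed (simp add: l.add e.add)
qed

lemma linear_linear_extension_image:
  assumes "Vector_Spaces.linear mscale mscale' \<phi>"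
  shows "\<phi> (linear_extension mscale g x) = linear_extension mscale' (\<lambda>u. \<phi> (g u)) x"
proof -
  interpret \<phi>: Vector_Spaces.linear mscale mscale' \<phi> by fact
  show ?thesis by (simp add: linear_extension_def \<phi>.sum \<phi>.scale)
qed

text \<open>The coordinate map applies the polynomial in \<open>T\<close> to a free generator
  \<open>v\<close>; independence of \<open>v\<close> gives injectivity and spanning gives
  surjectivity.\<close>

lemma free_rank_one_coordinates:
  fixes mscale :: "complex \<Rightarrow> 'v::ab_group_add \<Rightarrow> 'v"
  assumes "Vector_Spaces.linear mscale mscale T" and "free_of_rank_one (poly_action mscale T)"
  obtains \<theta> where "Vector_Spaces.linear smult mscale \<theta>" "bij \<theta>" "\<And>p. \<theta> ([:0, 1:] * p) = T (\<theta> p)"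
proof -
  interpret T: Vector_Spaces.linear mscale mscale T by fact
  interpret P: module "poly_action mscale T" by (rule poly_action_module) fact
  obtain v where v: "\<not> P.dependent {v}" "P.span {v} = UNIV"
    using assms(2) unfolding free_of_rank_one_def by blast
  define \<theta> where "\<theta> p = poly_action mscale T p v" for p
  have const: "poly_action mscale T [:c:] w = mscale c w" for c w
    by (simp add: poly_action_def)
  have var: "poly_action mscale T [:0, 1:] w = T w" for w
    by (simp add: poly_action_def)
  show thesis
  proof (rule that[of \<theta>])
    show "Vector_Spaces.linear smult mscale \<theta>"
    proof unfold_locales
      fix p q :: "complex poly" and c
      show "\<theta> (p + q) = \<theta> p + \<theta> q" by (simp add: \<theta>_def P.scale_left_distrib)
      have "\<theta> ([:c:] * p) = mscale c (\<theta> p)" by (simp only: \<theta>_def P.scale_scale[symmetric] const)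
      then show "\<theta> (smult c p) = mscale c (\<theta> p)" by simp
    qed (simp_all add: smult_add_left smult_add_right)
    show "bij \<theta>"
    proof (rule bijI)
      show "inj \<theta>"
      proof (rule injI)
        fix p q assume "\<theta> p = \<theta> q"
        then have "poly_action mscale T (p - q) v = 0" by (simp add: \<theta>_def P.scale_left_diff_distrib)
        then have "p - q = 0"
          using P.independentD[OF v(1), of "{v}" "\<lambda>_. p - q" v] by simp
        then show "p = q" by simp
      qed
      show "surj \<theta>" using v(2) by (simp add: P.span_singleton \<theta>_def)
    qed
    show "\<theta> ([:0, 1:] * p) = T (\<theta> p)" for p
      by (simp only: \<theta>_def P.scale_scale[symmetric] var)
  qed
qed

theorem theorem4p3:
  fixes a b :: complex
    and mscale :: "complex \<Rightarrow> 'v::ab_group_add \<Rightarrow> 'v"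
    and act :: "hv \<Rightarrow> 'v \<Rightarrow> 'v"
  assumes "0 \<le> Re a" and "Re a < 1"
    and "lie_module hv_scale (hv_bracket a b) mscale act"
    and "free_of_rank_one (poly_action mscale (act (Poly_Mapping.single (L 0 0) 1)))"
  shows "\<exists>lam \<alpha> \<beta> \<gamma> \<kappa>. lam \<noteq> 0 \<and>
    lie_module_isomorphic hv_scale (hv_bracket a b) mscale act
      smult (\<Omega> a b lam \<alpha> \<beta> \<gamma> \<kappa>)"
proof -
  interpret M: lie_module hv_scale "hv_bracket a b" mscale act by fact
  interpret l: Vector_Spaces.linear hv_scale mscale "\<lambda>x. act x v" for v by (rule M.act_linear_left)
  interpret r: Vector_Spaces.linear mscale mscale "act x" for x by (rule M.act_linear_right)
  obtain \<theta> where \<theta>: "Vector_Spaces.linear smult mscale \<theta>" "bij \<theta>"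
    "\<And>p. \<theta> ([:0, 1:] * p) = act (Poly_Mapping.single (L 0 0) 1) (\<theta> p)"
    using free_rank_one_coordinates[OF M.act_linear_right assms(4)] by metis
  interpret \<theta>: Vector_Spaces.linear smult mscale \<theta> by fact
  define \<phi> where "\<phi> = inv \<theta>"
  have \<phi>_\<theta> [simp]: "\<phi> (\<theta> p) = p" for p unfolding \<phi>_def using \<theta>(2) by (simp add: bij_is_inj)
  have \<theta>_\<phi> [simp]: "\<theta> (\<phi> v) = v" for v unfolding \<phi>_def using \<theta>(2) by (simp add: bij_is_surj surj_f_inv_f)
  have \<phi>_linear: "Vector_Spaces.linear mscale smult \<phi>"
  proof unfold_locales
    fix v w c
    have "\<phi> (\<theta> (\<phi> v) + \<theta> (\<phi> w)) = \<phi> v + \<phi> w" "\<phi> (mscale c (\<theta> (\<phi> v))) = smult c (\<phi> v)"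
      by (simp_all only: \<theta>.add[symmetric] \<theta>.scale[symmetric] \<phi>_\<theta>)
    then show "\<phi> (v + w) = \<phi> v + \<phi> w" "\<phi> (mscale c v) = smult c (\<phi> v)" by simp_all
  qed
  interpret \<phi>: Vector_Spaces.linear mscale smult \<phi> by fact
  define X where "X u p = \<phi> (act (Poly_Mapping.single u 1) (\<theta> p))" for u p
  have \<phi>_act_single: "\<phi> (act (Poly_Mapping.single u c) (\<theta> p)) = smult c (X u p)" for u c p
    using l.scale[of c "Poly_Mapping.single u 1" "\<theta> p"] by (simp add: X_def \<phi>.scale)
  have comm: "X u (X w p) - X w (X u p) = \<phi> (act (hv_bracket_basis a b u w) (\<theta> p))" for u w p
  proof -
    interpret hv: vector_space hv_scale by (rule vector_space_hv)
    show ?thesis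
      using M.act_bracket[of "Poly_Mapping.single u 1" "Poly_Mapping.single w 1" "\<theta> p"]
      by (simp add: X_def \<phi>.diff[symmetric])
  qed
  interpret X: rank_one_action a b X
  proof
    show "X (L 0 0) p = [:0, 1:] * p" for p
      unfolding X_def \<theta>(3)[symmetric] by (simp only: \<phi>_\<theta>)
    show "X (L i m) (X (L j n) p) - X (L j n) (X (L i m) p) =
        smult (of_int j - of_int i) (X (L (i + j) (m + n)) p)
        + smult (of_nat n - of_nat m) (X (L (i + j) (m + n + 1)) p)" for i j m n p
      unfolding comm hv_bracket_basis.simps l.add \<phi>.add \<phi>_act_single ..
    show "X (L i m) (X (H j n) p) - X (H j n) (X (L i m) p) =
        smult (a + of_int j + b * of_int i) (X (H (i + j) (m + n)) p)
        + smult (of_nat n + b * of_nat m) (X (H (i + j) (m + n + 1)) p)" for i j m n p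
      unfolding comm hv_bracket_basis.simps l.add \<phi>.add \<phi>_act_single ..
    show "X (H i m) (X (H j n) p) = X (H j n) (X (H i m) p)" for i m j n p
      using comm[of "H i m" "H j n" p] by (simp add: l.zero \<phi>.zero)
  qed (simp_all add: X_def r.add \<theta>.add \<phi>.add r.scale \<theta>.scale \<phi>.scale)
  obtain lam \<alpha> where lam: "lam \<noteq> 0" "\<And>i. X (L i 0) 1 = smult (lam powi i) [:- (of_int i * \<alpha>), 1:]"
    using X.L_level0_form by blast
  interpret X: rank_one_action_normalized a b X lam \<alpha>
    by unfold_locales (rule lam)+
  \<comment> \<open>The strip \<open>0 \<le> Re a < 1\<close> contains no integer other than
    0.\<close>
  have "a + of_int k \<noteq> 0" if "a \<noteq> 0" for k
  proof
    assume "a + of_int k = 0"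
    then have a: "a = of_int (- k)" by (simp add: eq_neg_iff_add_eq_0)
    then have "0 \<le> - k" "- k < 1" using assms(1,2) by simp_all
    then show False using a that by simp
  qed
  then obtain \<gamma> \<kappa> where X_eq: "\<And>u f. X u f = \<Omega>_basis a b lam \<alpha> X.\<beta> \<gamma> \<kappa> u f"
    using X.action_eq_\<Omega> by blast
  \<comment> \<open>Both sides are linear extensions in \<open>x\<close>, so agreement on basis
    elements suffices.\<close>
  have "\<phi> (act x v) = \<Omega> a b lam \<alpha> X.\<beta> \<gamma> \<kappa> x (\<phi> v)" for x v
    unfolding \<Omega>_def X_eq[symmetric]
    by (subst act_eq_linear_extension[OF assms(3)], subst linear_linear_extension_image[OF \<phi>_linear])
      (simp add: X_def)
  moreover have "bij \<phi>" unfolding \<phi>_def by (rule bij_imp_bij_inv) fact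
  ultimately have "lie_module_isomorphic hv_scale (hv_bracket a b) mscale act smult (\<Omega> a b lam \<alpha> X.\<beta> \<gamma> \<kappa>)"
    by (intro lie_module_isomorphicI[OF assms(3) \<phi>_linear])
  with lam(1) show ?thesis by blast
qed

end
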